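(* Let $\mathbb{D}_n$ ($n\geq4$) be the tree with $n$ vertices given by the Dynkin diagram of type $\mathbb{D}$. The number of points over $\mathbb{F}_q$ on the varieties attached to $\mathbb{D}_n$ is given by $$N_{\mathbb{D}_n}^{\mathtt{versal}}=\frac{q^{n+3}-q^{n+2}+q^n+q^3-q+1}{q+1}\quad\text{and}\quad N_{\mathbb{D}_n}^{\mathtt{generic}}=(q^{n/2}-1)^2$$ if $n$ is even, and by $$N_{\mathbb{D}_n}^{\mathtt{versal}}=\frac{q^{n+3}-q^{n+2}+q^n-q^3+q-1}{q^2-1}\quad\text{and}\quad N_{\mathbb{D}_n}^{\mathtt{generic}}=q^n-1$$ if $n$ is odd.
   Context: $\mathbb{D}_n$ has vertices $1,\dots,n$ and edges $1-3$, $2-3$, and $i-(i+1)$ for $3\leq i\leq n-1$. A tree is a finite connected simply-connected graph. A vertex cover of a tree $T$ is a set of vertices meeting every edge; a minimum vertex cover is one of minimal cardinality. Canonical coloring: a vertex of $T$ is green if it lies in all minimum vertex covers, orange if it lies in some but not all minimum vertex covers, red if it lies in none. A matching of $T$ is a set of edges (called dominoes) such that every vertex lies in at most one of them; a maximum matching is one of maximal cardinality. Known fact: every maximum matching covers all orange and green vertices, so uncovered vertices are red. The red-green components of $T$ are the connected components of the graph whose vertices are the red and green vertices of $T$ and whose edges are the edges of $T$ with one red end and one green end. For $\mathbb{D}_n$ there is exactly one red-green component: for $n$ odd it consists of the red vertices $1,2$ and the green vertex $3$ (the other vertices are orange); for $n$ even it is the whole tree, with red vertices $1,2$ and all even vertices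 $\geq4$, and green vertices all odd vertices $\geq3$. Varieties over $k=\mathbb{F}_q$: given $T$, a function $\phi$ from the set of red-green components of $T$ to $\{\mathtt{generic},\mathtt{versal}\}$, a maximum matching $M$, and for every component $C$ with $\phi(C)=\mathtt{generic}$ and every vertex $u$ of $C$ not covered by $M$ a fixed value $\alpha_u\in k^\times$, $X^\phi_T$ is the affine scheme over $k$ with variables $x_i,x'_i$ for all vertices $i$ of $T$ and $\alpha_i$ for all vertices $i$ not covered by $M$ lying in components $C$ with $\phi(C)=\mathtt{versal}$, defined by the equations $x_ix'_i=1+\alpha_i\prod_{j} x_j$ for all vertices $i$ (product over the vertices $j$ adjacent to $i$) and the condition that all variables $\alpha_i$ are invertible; here $\alpha_i=1$ whenever $i$ is covered by $M$. When $\phi$ is constant one writes $X_T^{\mathtt{generic}}$, $X_T^{\mathtt{versal}}$; $N_T^{\mathtt{generic}}$, $N_T^{\mathtt{versal}}$ denote the corresponding numbers of $\mathbb{F}_q$-points. Genericity condition (always assumed for every generic component $C$): a non-empty set $S$ of red vertices of $C$ is admissible if every green vertex of $C$ has either $0$ or $2$ neighbors in $S$. For every admissible set $S$ and every choice of signs $\varepsilon:S\to\{1,-1\}$ such that two distinct elements of $S$ sharing a common green neighbor have opposite signs, one requires $\prod_{i\in S}\alpha_i^{\varepsilon_i}\neq(-1)^{\#S}$. The generic formulas hold for every choice of parameters satisfying this condition. *)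

theory Defs
  imports Complex_Main "HOL-Library.FuncSet" "HOL-Library.Cardinality"
begin

text \<open>Finite simple graphs are given by a vertex set and a set of edges, an edge being the
  two-element set of its ends.\<close>

record 'v ugraph =
  verts :: "'v set"
  edges :: "'v set set"

definition adjacent :: "'v ugraph \<Rightarrow> 'v \<Rightarrow> 'v \<Rightarrow> bool" where
  "adjacent T u v \<longleftrightarrow> {u, v} \<in> edges T"

definition neighbors :: "'v ugraph \<Rightarrow> 'v \<Rightarrow> 'v set" where
  "neighbors T v = {w \<in> verts T. adjacent T v w}"

definition vertex_cover :: "'v ugraph \<Rightarrow> 'v set \<Rightarrow> bool" where
  "vertex_cover T S \<longleftrightarrow> S \<subseteq> verts T \<and> (\<forall>e\<in>edges T. e \<inter> S \<noteq> {})"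

definition minimum_vertex_cover :: "'v ugraph \<Rightarrow> 'v set \<Rightarrow> bool" where
  "minimum_vertex_cover T S \<longleftrightarrow>
     vertex_cover T S \<and> (\<forall>S'. vertex_cover T S' \<longrightarrow> card S \<le> card S')"

definition green :: "'v ugraph \<Rightarrow> 'v \<Rightarrow> bool" where
  "green T v \<longleftrightarrow> v \<in> verts T \<and> (\<forall>S. minimum_vertex_cover T S \<longrightarrow> v \<in> S)"

definition red :: "'v ugraph \<Rightarrow> 'v \<Rightarrow> bool" where
  "red T v \<longleftrightarrow> v \<in> verts T \<and> (\<forall>S. minimum_vertex_cover T S \<longrightarrow> v \<notin> S)"

definition orange :: "'v ugraph \<Rightarrow> 'v \<Rightarrow> bool" where
  "orange T v \<longleftrightarrow> v \<in> verts T \<and>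
     (\<exists>S. minimum_vertex_cover T S \<and> v \<in> S) \<and> (\<exists>S. minimum_vertex_cover T S \<and> v \<notin> S)"

definition matching :: "'v ugraph \<Rightarrow> 'v set set \<Rightarrow> bool" where
  "matching T M \<longleftrightarrow> M \<subseteq> edges T \<and> (\<forall>v\<in>verts T. \<forall>e\<in>M. \<forall>f\<in>M. v \<in> e \<and> v \<in> f \<longrightarrow> e = f)"

definition maximum_matching :: "'v ugraph \<Rightarrow> 'v set set \<Rightarrow> bool" where
  "maximum_matching T M \<longleftrightarrow>
     matching T M \<and> (\<forall>M'. matching T M' \<longrightarrow> card M' \<le> card M)"

definition uncovered :: "'v ugraph \<Rightarrow> 'v set set \<Rightarrow> 'v set" where
  "uncovered T M = verts T - \<Union>M"

definition connected_components :: "'v ugraph \<Rightarrow> 'v set set" where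
  "connected_components H =
     verts H // {(u, v). u \<in> verts H \<and> v \<in> verts H \<and> (u, v) \<in> {(a, b). adjacent H a b}\<^sup>*}"

definition red_green_graph :: "'v ugraph \<Rightarrow> 'v ugraph" where
  "red_green_graph T =
     \<lparr>verts = {v. red T v \<or> green T v},
      edges = {e \<in> edges T. \<exists>u v. e = {u, v} \<and> red T u \<and> green T v}\<rparr>"

text \<open>A red-green component is represented by its set of vertices.\<close>

definition red_green_components :: "'v ugraph \<Rightarrow> 'v set set" where
  "red_green_components T = connected_components (red_green_graph T)"

datatype kind = Generic | Versal

definition vertices_of_kind :: "'v ugraph \<Rightarrow> ('v set \<Rightarrow> kind) \<Rightarrow> kind \<Rightarrow> 'v set" where
  "vertices_of_kind T \<phi> \<kappa> = \<Union>{C \<in> red_green_components T. \<phi> C = \<kappa>}"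

definition coefficient :: "'v set set \<Rightarrow> ('v \<Rightarrow> 'k::field) \<Rightarrow> 'v \<Rightarrow> 'k" where
  "coefficient M \<alpha> v = (if v \<in> \<Union>M then 1 else \<alpha> v)"

text \<open>The points over the field \<open>'k\<close> of the scheme attached to \<open>T\<close>, \<open>\<phi>\<close>, \<open>M\<close> and the fixed values
  \<open>a\<close>. A point consists of the coordinates \<open>x\<close> and \<open>x'\<close>, indexed by the vertices, and the invertible
  coordinates \<open>b\<close>, indexed by the uncovered vertices in versal components. Coordinate families are
  extensional functions, so that distinct functions are distinct points. Only the values of \<open>a\<close> at
  the uncovered vertices in generic components matter, since every uncovered vertex is red.\<close>

definition variety_points ::
  "'v ugraph \<Rightarrow> ('v set \<Rightarrow> kind) \<Rightarrow> 'v set set \<Rightarrow> ('v \<Rightarrow> 'k::field) \<Rightarrow>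
     (('v \<Rightarrow> 'k) \<times> ('v \<Rightarrow> 'k) \<times> ('v \<Rightarrow> 'k)) set" where
  "variety_points T \<phi> M a =
     {(x, x', b).
        x \<in> verts T \<rightarrow>\<^sub>E UNIV \<and> x' \<in> verts T \<rightarrow>\<^sub>E UNIV \<and>
        b \<in> (uncovered T M \<inter> vertices_of_kind T \<phi> Versal) \<rightarrow>\<^sub>E (UNIV - {0}) \<and>
        (\<forall>i\<in>verts T.
           x i * x' i =
             1 + coefficient M (\<lambda>v. if v \<in> vertices_of_kind T \<phi> Versal then b v else a v) i
                 * (\<Prod>j\<in>neighbors T i. x j))}"

definition admissible :: "'v ugraph \<Rightarrow> 'v set \<Rightarrow> 'v set \<Rightarrow> bool" where
  "admissible T C S \<longleftrightarrow>
     S \<noteq> {} \<and> S \<subseteq> {v \<in> C. red T v} \<and>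
     (\<forall>w\<in>C. green T w \<longrightarrow> card (neighbors T w \<inter> S) \<in> {0, 2})"

definition sign_choice :: "'v ugraph \<Rightarrow> 'v set \<Rightarrow> 'v set \<Rightarrow> ('v \<Rightarrow> int) \<Rightarrow> bool" where
  "sign_choice T C S \<epsilon> \<longleftrightarrow>
     (\<forall>i\<in>S. \<epsilon> i \<in> {1, -1}) \<and>
     (\<forall>i\<in>S. \<forall>j\<in>S. i \<noteq> j \<and> (\<exists>w\<in>C. green T w \<and> adjacent T i w \<and> adjacent T j w)
        \<longrightarrow> \<epsilon> i = - \<epsilon> j)"

definition genericity_condition ::
  "'v ugraph \<Rightarrow> ('v set \<Rightarrow> kind) \<Rightarrow> 'v set set \<Rightarrow> ('v \<Rightarrow> 'k::field) \<Rightarrow> bool" where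
  "genericity_condition T \<phi> M a \<longleftrightarrow>
     (\<forall>C\<in>red_green_components T. \<phi> C = Generic \<longrightarrow>
        (\<forall>S \<epsilon>. admissible T C S \<and> sign_choice T C S \<epsilon> \<longrightarrow>
           (\<Prod>i\<in>S. coefficient M a i powi \<epsilon> i) \<noteq> (- 1) ^ card S))"

definition generic_parameters ::
  "'v ugraph \<Rightarrow> ('v set \<Rightarrow> kind) \<Rightarrow> 'v set set \<Rightarrow> ('v \<Rightarrow> 'k::field) \<Rightarrow> bool" where
  "generic_parameters T \<phi> M a \<longleftrightarrow>
     (\<forall>u\<in>uncovered T M \<inter> vertices_of_kind T \<phi> Generic. a u \<noteq> 0) \<and>
     genericity_condition T \<phi> M a"

definition dynkin_D :: "nat \<Rightarrow> nat ugraph" where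
  "dynkin_D n =
     \<lparr>verts = {1..n},
      edges = {{1, 3}, {2, 3}} \<union> {{i, i + 1} | i. 3 \<le> i \<and> i \<le> n - 1}\<rparr>"

end

(* Write c_i for the coefficient in the equation at i. For given x, this equation has one
   solution x'_i if x_i is nonzero, and q or no solutions if x_i = 0.
   Eliminating the vertices of the path 4, ..., n one after the other, the number A_j(y) of solutions of the equations at j + 1, ..., n, given x_j = y nonzero, satisfies
     A_j(y) = (sum of A_{j+1}(z) over nonzero z) + q A_{j+2}(-1 / (c_{j+1} y)),
   because x_{j+1} = 0 forces x_{j+2} = -1 / (c_{j+1} y). Hence A_j is constant for n - j even, and
   constant up to one special value of y for n - j odd. Summing over x_1, x_2, x_3, the number of
   points depends only on n, q and the coincidences among -1 / c_1, -1 / c_2 and, for n even, the special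
   value t of the path. Genericity excludes exactly these coincidences; in the versal case,
   all values but one run independently over the nonzero elements.

   The colours and the uncovered vertices come from a tight pair: a matching and a vertex cover of
   the same size, so that the cover is contained in the union of the matching. *)
theory Submission
  imports Defs
begin

subsection \<open>Counting by elimination\<close>

lemma sum_PiE_insert:
  assumes "i \<notin> I"
  shows "(\<Sum>u\<in>PiE (insert i I) B. F u) = (\<Sum>z\<in>B i. \<Sum>u\<in>PiE I B. F (u(i := z)))"
proof -
  have "(\<Sum>u\<in>PiE (insert i I) B. F u)
      = (\<Sum>p\<in>B i \<times> PiE I B. F ((\<lambda>(z, u). u(i := z)) p))"
    unfolding PiE_insert_eq using inj_combinator[OF assms, of B]
    by (subst sum.reindex) (auto simp: o_def)
  then show ?thesis
    by (simp add: sum.cartesian_product case_prod_beta)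
qed

lemma card_field_gt_1: "CARD('k::{field,finite}) > 1"
proof -
  have "card {0, 1 :: 'k} \<le> CARD('k)" by (rule card_mono) auto
  then show ?thesis by simp
qed

lemma card_units: "real (card (UNIV - {0 :: 'k::{field,finite}})) = real CARD('k) - 1"
  by (simp add: card_Diff_singleton of_nat_diff)

lemma sum_spike:
  fixes t :: "'k::{field,finite}" and f g :: real
  assumes "t \<noteq> 0"
  shows "(\<Sum>z\<in>UNIV - {0}. f + (if z = t then g else 0)) = (real CARD('k) - 1) * f + g"
  using assms by (simp add: sum.distrib sum.delta' sum.delta card_units)

lemma sum_unique_nonzero:
  assumes "finite A" and "t \<in> A" and "\<And>z. z \<in> A \<Longrightarrow> z \<noteq> t \<Longrightarrow> F z = (0::real)"
  shows "(\<Sum>z\<in>A. F z) = F t"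
proof -
  have "(\<Sum>z\<in>A. F z) = (\<Sum>z\<in>{t}. F z)"
    by (rule sum.mono_neutral_right) (use assms in auto)
  then show ?thesis by simp
qed

lemma power2_power: "(x\<^sup>2) ^ r = (x ^ r)\<^sup>2" for x :: "'a::monoid_mult"
  by (simp flip: power_mult add: mult.commute)

text \<open>The number of choices for x'_i when x_i = s and the right-hand side of the equation at i
  is t.\<close>

definition cofactors :: "'k::{field,finite} \<Rightarrow> 'k \<Rightarrow> real" where
  "cofactors s t = real (card {s'. s * s' = t})"

lemma cofactors_nonzero [simp]: "s \<noteq> 0 \<Longrightarrow> cofactors s t = 1"
proof -
  assume "s \<noteq> 0"
  then have "{s'. s * s' = t} = {t / s}"
    by (auto simp: field_simps)
  then show ?thesis by (simp add: cofactors_def)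
qed

lemma cofactors_zero: "cofactors (0 :: 'k::{field,finite}) t = (if t = 0 then real CARD('k) else 0)"
  by (auto simp: cofactors_def)

lemma sum_nonzero_split:
  fixes F :: "'k::{field,finite} \<Rightarrow> real"
  shows "(\<Sum>z\<in>UNIV. F z) = (\<Sum>z\<in>UNIV - {0}. F z) + F 0"
  by (subst sum.remove[of _ 0]) auto

text \<open>At a vertex with value 0 the equation forces the unit w = -1 / d at the next vertex and
  leaves q choices for x'. The factor \<open>cofactors w 1\<close> belongs to that next vertex,
  whose right-hand side is 1 beside a zero.\<close>

lemma sum_cofactors_zero:
  fixes F :: "'k::{field,finite} \<Rightarrow> real"
  assumes "d \<noteq> 0"
  shows "(\<Sum>w\<in>UNIV. cofactors 0 (1 + d * w) * (cofactors w 1 * F w))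
    = real CARD('k) * F (- 1 / d)"
proof -
  have iff: "1 + d * w = 0 \<longleftrightarrow> w = - 1 / d" for w
    using assms by (auto simp: field_simps eq_neg_iff_add_eq_0)
  show ?thesis
    by (subst sum_unique_nonzero[where t = "- 1 / d"])
      (use assms in \<open>auto simp: cofactors_zero iff\<close>)
qed

text \<open>This is the count at an end vertex x with neighbour y: each nonzero x gives one
  solution, and x = 0 gives q solutions or none.\<close>

lemma sum_cofactors:
  fixes d y :: "'k::{field,finite}"
  assumes "d \<noteq> 0"
  shows "(\<Sum>x\<in>UNIV. cofactors x (1 + d * y)) =
    real CARD('k) - 1 + (if y = - 1 / d then real CARD('k) else 0)"
proof -
  have "1 + d * y = 0 \<longleftrightarrow> y = - 1 / d"
    using assms by (auto simp: field_simps eq_neg_iff_add_eq_0)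
  then show ?thesis
    by (subst sum_nonzero_split) (simp add: cofactors_zero card_units)
qed

section \<open>Elimination along the path\<close>

context
  fixes c :: "nat \<Rightarrow> 'k::{field,finite}" and n :: nat
begin

text \<open>A fictitious vertex \<open>n + 1\<close> with value \<open>1\<close> makes the equation at \<open>n\<close> uniform with the others.\<close>

definition chain_weight :: "nat \<Rightarrow> 'k \<Rightarrow> (nat \<Rightarrow> 'k) \<Rightarrow> real" where
  "chain_weight j y u = (\<Prod>i\<in>{j<..n}. cofactors (u i)
     (1 + c i * ((u(j := y)) (i - 1) * (u(Suc n := 1)) (Suc i))))"

text \<open>This is the number A_j(y) from the introduction, here for arbitrary y.\<close>

definition chain_count :: "nat \<Rightarrow> 'k \<Rightarrow> real" where
  "chain_count j y = (\<Sum>u\<in>{j<..n} \<rightarrow>\<^sub>E UNIV. chain_weight j y u)"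

lemma interval_insert: "j < n \<Longrightarrow> {j<..n} = insert (Suc j) {Suc j<..n}"
  by auto

lemma chain_weight_step:
  assumes "j < n"
  shows "chain_weight j y (u(Suc j := z)) =
    cofactors z (1 + c (Suc j) * (y * (u(Suc n := 1)) (Suc (Suc j)))) * chain_weight (Suc j) z u"
proof -
  have "chain_weight j y (u(Suc j := z)) =
      cofactors z (1 + c (Suc j) * (y * (u(Suc n := 1)) (Suc (Suc j)))) *
      (\<Prod>i\<in>{Suc j<..n}. cofactors ((u(Suc j := z)) i)
        (1 + c i * ((u(Suc j := z, j := y)) (i - 1) * (u(Suc j := z, Suc n := 1)) (Suc i))))"
    unfolding chain_weight_def interval_insert[OF assms] by (subst prod.insert) auto
  \<comment> \<open>For i > j + 1 the index i - 1 is at least j + 1, so the value y at j is no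
    longer seen.\<close>
  also have "(\<Prod>i\<in>{Suc j<..n}. cofactors ((u(Suc j := z)) i)
        (1 + c i * ((u(Suc j := z, j := y)) (i - 1) * (u(Suc j := z, Suc n := 1)) (Suc i))))
      = chain_weight (Suc j) z u"
    unfolding chain_weight_def by (intro prod.cong) auto
  finally show ?thesis .
qed

lemma chain_count_end: "chain_count n y = 1"
  by (simp add: chain_count_def chain_weight_def)

lemma chain_sum_step:
  assumes "j < n"
  shows "(\<Sum>u\<in>{j<..n} \<rightarrow>\<^sub>E UNIV. g (u (Suc j)) * chain_weight j y u) =
    (\<Sum>z\<in>UNIV. \<Sum>u\<in>{Suc j<..n} \<rightarrow>\<^sub>E UNIV. g z *
       (cofactors z (1 + c (Suc j) * (y * (u(Suc n := 1)) (Suc (Suc j)))) * chain_weight (Suc j) z u))"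
  unfolding interval_insert[OF assms]
  by (subst sum_PiE_insert) (auto simp: chain_weight_step[OF assms])

text \<open>A zero at j turns the right-hand side at j + 1 into 1, so that equation no longer
  involves x_(j+2) and the rest sums to a chain count. The weight g makes room for the equation at
  j.\<close>

lemma chain_sum_zero:
  assumes "j < n"
  shows "(\<Sum>u\<in>{j<..n} \<rightarrow>\<^sub>E UNIV. g (u (Suc j)) * chain_weight j 0 u) =
    (\<Sum>z\<in>UNIV. g z * (cofactors z 1 * chain_count (Suc j) z))"
  unfolding chain_sum_step[OF assms] chain_count_def
  by (simp add: sum_distrib_left)

lemma chain_count_last:
  assumes "j < n" and "Suc j = n" and "c n \<noteq> 0"
  shows "chain_count j y = real CARD('k) - 1 + (if y = - 1 / c n then real CARD('k) else 0)"
  unfolding chain_count_def using chain_sum_step[OF assms(1), of "\<lambda>_. 1" y] assms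
  by (simp add: chain_weight_def sum_cofactors)

lemma chain_count_rec:
  assumes "Suc j < n" and "c (Suc j) \<noteq> 0" and "y \<noteq> 0"
  shows "chain_count j y = (\<Sum>z\<in>UNIV - {0}. chain_count (Suc j) z) +
    real CARD('k) * chain_count (Suc (Suc j)) (- 1 / (c (Suc j) * y))"
proof -
  have "chain_count j y = (\<Sum>z\<in>UNIV. \<Sum>u\<in>{Suc j<..n} \<rightarrow>\<^sub>E UNIV.
      cofactors z (1 + c (Suc j) * (y * u (Suc (Suc j)))) * chain_weight (Suc j) z u)"
    unfolding chain_count_def using chain_sum_step[of j "\<lambda>_. 1" y] assms(1) by simp
  \<comment> \<open>A nonzero z admits exactly one x'_(j+1) whatever the right-hand side is, so only
    the equations further along the path remain.\<close>
  also have "\<dots> = (\<Sum>z\<in>UNIV - {0}. chain_count (Suc j) z) +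
     (\<Sum>u\<in>{Suc j<..n} \<rightarrow>\<^sub>E UNIV.
      cofactors 0 (1 + c (Suc j) * (y * u (Suc (Suc j)))) * chain_weight (Suc j) 0 u)"
    by (subst sum_nonzero_split) (simp add: chain_count_def)
  \<comment> \<open>For z = 0 the equation at j + 1 is a weight on w = x_(j+2), which has a zero on
    its left.\<close>
  also have "(\<Sum>u\<in>{Suc j<..n} \<rightarrow>\<^sub>E UNIV.
      cofactors 0 (1 + c (Suc j) * (y * u (Suc (Suc j)))) * chain_weight (Suc j) 0 u)
    = (\<Sum>w\<in>UNIV. cofactors 0 (1 + (c (Suc j) * y) * w) *
        (cofactors w 1 * chain_count (Suc (Suc j)) w))"
    using chain_sum_zero[OF assms(1), of "\<lambda>w. cofactors 0 (1 + c (Suc j) * (y * w))"]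
    by (simp add: mult.assoc)
  also have "\<dots> = real CARD('k) * chain_count (Suc (Suc j)) (- 1 / (c (Suc j) * y))"
    using assms(2,3) by (simp add: sum_cofactors_zero)
  finally show ?thesis .
qed

text \<open>The only nonzero value at the vertex \<open>n - 2 r - 1\<close> with an exceptional count.\<close>

fun special_value :: "nat \<Rightarrow> 'k" where
  "special_value 0 = - 1 / c n"
| "special_value (Suc r) = - 1 / (c (n - 2 * Suc r) * special_value r)"

lemma special_value_nonzero:
  assumes "\<And>i. i \<in> {n - 2 * r..n} \<Longrightarrow> c i \<noteq> 0"
  shows "special_value r \<noteq> 0"
  using assms
proof (induction r)
  case (Suc r)
  have "special_value r \<noteq> 0" by (rule Suc.IH) (use Suc.prems in auto)
  moreover have "c (n - 2 * Suc r) \<noteq> 0" by (rule Suc.prems) auto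
  ultimately show ?case by simp
qed simp

text \<open>The two formulas need a joint induction. Summing over the units flattens the exceptional
  value of an odd level into the constant of the next even level. The term with factor q carries the
  exceptional value from one odd level to the next and multiplies its height by q.\<close>

lemma chain_count_values:
  defines "q \<equiv> real CARD('k)"
  assumes "2 * r < n" and "\<And>i. i \<in> {n - 2 * r..n} \<Longrightarrow> c i \<noteq> 0" and "y \<noteq> 0"
  shows chain_count_even:
      "chain_count (n - 2 * r) y = (q ^ (2 * r + 2) - 1) / (q\<^sup>2 - 1)" (is "?even r y")
    and chain_count_odd:
      "chain_count (n - 2 * r - 1) y = (q ^ (r + 1) - 1) * (q ^ (r + 2) - 1) / (q\<^sup>2 - 1) +
        (if y = special_value r then q ^ (r + 1) else 0)" (is "?odd r y")
proof -
  have "q > 1" unfolding q_def using card_field_gt_1 by simp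
  then have q: "q\<^sup>2 - 1 \<noteq> 0" "q + 1 \<noteq> 0" "q - 1 \<noteq> 0"
    by (auto simp: power2_eq_1_iff)
  have "(\<forall>y. y \<noteq> 0 \<longrightarrow> ?even r y) \<and> (\<forall>y. y \<noteq> 0 \<longrightarrow> ?odd r y)"
    using assms(2,3)
  proof (induction r)
    case 0
    have "?even 0 y" for y
      using q by (simp add: chain_count_end power2_eq_square)
    moreover have "?odd 0 y" for y
      using q 0 chain_count_last[of "n - 1" y]
      by (auto simp: power2_eq_square numeral_2_eq_2 divide_simps q_def)
    ultimately show ?case by blast
  next
    case (Suc r)
    define m where "m = n - 2 * Suc r"
    have m: "m > 0" "Suc m < n" "n - 2 * r = Suc (Suc m)" "n - 2 * r - 1 = Suc m"
      using Suc.prems(1) by (auto simp: m_def)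
    have nz: "c i \<noteq> 0" if "i \<in> {m..n}" for i
      using Suc.prems(2) that by (auto simp: m_def)
    have IH: "\<forall>y. y \<noteq> 0 \<longrightarrow> ?even r y" "\<forall>y. y \<noteq> 0 \<longrightarrow> ?odd r y"
      using Suc.IH nz Suc.prems(1) m(3) by auto
    \<comment> \<open>Being a unit, the special value is met exactly once when summing over the
      nonzero z.\<close>
    have sv: "special_value r \<noteq> 0"
      using special_value_nonzero nz m by auto
    have even: "?even (Suc r) y" if "y \<noteq> 0" for y
    proof -
      have "(\<Sum>z\<in>UNIV - {0}. chain_count (Suc m) z) = (\<Sum>z\<in>UNIV - {0}.
          (q ^ (r + 1) - 1) * (q ^ (r + 2) - 1) / (q\<^sup>2 - 1) +
          (if z = special_value r then q ^ (r + 1) else 0))"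
        using IH(2) m(4) by (intro sum.cong) auto
      then have "chain_count m y =
          (q - 1) * ((q ^ (r + 1) - 1) * (q ^ (r + 2) - 1) / (q\<^sup>2 - 1)) + q ^ (r + 1) +
          q * ((q ^ (2 * r + 2) - 1) / (q\<^sup>2 - 1))"
        using chain_count_rec[of m y] IH m nz[of "Suc m"] that sv
        by (simp add: sum_spike q_def)
      also have "\<dots> = (q ^ (2 * Suc r + 2) - 1) / (q\<^sup>2 - 1)"
        using q by (simp add: divide_simps power_mult power2_power) algebra
      finally show ?thesis by (simp add: m_def)
    qed
    have "(\<Sum>z\<in>UNIV - {0}. chain_count m z) =
        (\<Sum>z\<in>UNIV - {0::'k}. (q ^ (2 * Suc r + 2) - 1) / (q\<^sup>2 - 1))"
      using even by (intro sum.cong) (auto simp: m_def)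
    then have sum_even: "(\<Sum>z\<in>UNIV - {0}. chain_count m z) =
        (q - 1) * ((q ^ (2 * r + 4) - 1) / (q\<^sup>2 - 1))"
      by (simp add: card_units q_def numeral_eq_Suc)
    have "?odd (Suc r) y" if "y \<noteq> 0" for y
    proof -
      \<comment> \<open>The exceptional value at m + 1 is hit for exactly one y at m - 1; solving
        for y gives the recursion of \<open>special_value\<close>.\<close>
      have iff: "- 1 / (c m * y) = special_value r \<longleftrightarrow> y = special_value (Suc r)"
        using sv that nz[of m] m
        unfolding special_value.simps m_def[symmetric] by (auto simp: field_simps)
      have alg: "(q ^ (Suc r + 1) - 1) * (q ^ (Suc r + 2) - 1) / (q\<^sup>2 - 1) =
          (q - 1) * ((q ^ (2 * r + 4) - 1) / (q\<^sup>2 - 1)) +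
          q * ((q ^ (r + 1) - 1) * (q ^ (r + 2) - 1) / (q\<^sup>2 - 1))"
        using q by (simp add: divide_simps power_add power_mult power2_power numeral_eq_Suc) algebra
      have "chain_count (m - 1) y =
          (q - 1) * ((q ^ (2 * r + 4) - 1) / (q\<^sup>2 - 1)) +
          q * ((q ^ (r + 1) - 1) * (q ^ (r + 2) - 1) / (q\<^sup>2 - 1) +
            (if y = special_value (Suc r) then q ^ (r + 1) else 0))"
        using chain_count_rec[of "m - 1" y] IH m nz[of m] that sum_even iff
        by (simp add: q_def del: special_value.simps)
      also have "\<dots> = (q ^ (Suc r + 1) - 1) * (q ^ (Suc r + 2) - 1) / (q\<^sup>2 - 1) +
        (if y = special_value (Suc r) then q ^ (Suc r + 1) else 0)"
        unfolding alg by (simp add: algebra_simps)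
      finally show ?thesis by (simp add: m_def)
    qed
    with even show ?case by blast
  qed
  with assms(4) show "?even r y" "?odd r y" by auto
qed


lemma chain_count_even_sum:
  defines "q \<equiv> real CARD('k)"
  assumes "2 * r < n" and "\<And>i. i \<in> {n - 2 * r..n} \<Longrightarrow> c i \<noteq> 0"
  shows "(\<Sum>y\<in>UNIV - {0}. chain_count (n - 2 * r) y) = (q ^ (2 * r + 2) - 1) / (q + 1)"
proof -
  have "q > 1" unfolding q_def using card_field_gt_1 by simp
  then have q: "q\<^sup>2 - 1 \<noteq> 0" "q + 1 \<noteq> 0"
    by (auto simp: power2_eq_1_iff)
  have "(\<Sum>y\<in>UNIV - {0}. chain_count (n - 2 * r) y) =
      (\<Sum>y\<in>UNIV - {0::'k}. (q ^ (2 * r + 2) - 1) / (q\<^sup>2 - 1))"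
    unfolding q_def using assms by (intro sum.cong refl chain_count_even) auto
  also have "\<dots> = (q - 1) * ((q ^ (2 * r + 2) - 1) / (q\<^sup>2 - 1))"
    by (simp add: card_units q_def)
  also have "\<dots> = (q ^ (2 * r + 2) - 1) / (q + 1)"
    using q by (simp add: divide_simps) algebra
  finally show ?thesis .
qed

text \<open>The exceptional value cancels the terms in \<open>q ^ (r + 1)\<close> and
  \<open>q ^ (r + 2)\<close> of the expanded constant part.\<close>

lemma chain_count_odd_sum:
  defines "q \<equiv> real CARD('k)"
  assumes "2 * r < n" and "\<And>i. i \<in> {n - 2 * r..n} \<Longrightarrow> c i \<noteq> 0"
  shows "(\<Sum>y\<in>UNIV - {0}. chain_count (n - 2 * r - 1) y) = (q ^ (2 * r + 3) + 1) / (q + 1)"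
proof -
  have "q > 1" unfolding q_def using card_field_gt_1 by simp
  then have q: "q\<^sup>2 - 1 \<noteq> 0" "q + 1 \<noteq> 0"
    by (auto simp: power2_eq_1_iff)
  have "(\<Sum>y\<in>UNIV - {0}. chain_count (n - 2 * r - 1) y) =
      (\<Sum>y\<in>UNIV - {0}. (q ^ (r + 1) - 1) * (q ^ (r + 2) - 1) / (q\<^sup>2 - 1) +
        (if y = special_value r then q ^ (r + 1) else 0))"
    unfolding q_def using assms by (intro sum.cong refl chain_count_odd) auto
  also have "\<dots> = (q - 1) * ((q ^ (r + 1) - 1) * (q ^ (r + 2) - 1) / (q\<^sup>2 - 1)) + q ^ (r + 1)"
    unfolding q_def using assms by (intro sum_spike special_value_nonzero) auto
  also have "\<dots> = (q ^ (2 * r + 3) + 1) / (q + 1)"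
    using q by (simp add: divide_simps power_add power_mult power2_power numeral_eq_Suc) algebra
  finally show ?thesis .
qed

end

section \<open>The tree with its branching vertex 3\<close>

lemma verts_dynkin_D: "verts (dynkin_D n) = {1..n}"
  by (simp add: dynkin_D_def)

lemma adjacent_dynkin_D:
  "adjacent (dynkin_D n) u v \<longleftrightarrow>
     {u, v} = {1, 3} \<or> {u, v} = {2, 3} \<or>
     (3 \<le> u \<and> u < n \<and> v = Suc u) \<or> (3 \<le> v \<and> v < n \<and> u = Suc v)"
  by (auto simp: adjacent_def dynkin_D_def doubleton_eq_iff)

lemma neighbors_dynkin_D:
  assumes "n \<ge> 4"
  shows "neighbors (dynkin_D n) 1 = {3}" "neighbors (dynkin_D n) 2 = {3}"
    "neighbors (dynkin_D n) 3 = {1, 2, 4}"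
    "\<lbrakk>4 \<le> i; i < n\<rbrakk> \<Longrightarrow> neighbors (dynkin_D n) i = {i - 1, Suc i}"
    "neighbors (dynkin_D n) n = {n - 1}"
  using assms
  by (auto simp: neighbors_def adjacent_dynkin_D verts_dynkin_D doubleton_eq_iff)

text \<open>The number of pairs (x, x') for fixed coefficients c, with x' already counted by the
  cofactors.\<close>

definition tree_count :: "nat \<Rightarrow> (nat \<Rightarrow> 'k::{field,finite}) \<Rightarrow> real" where
  "tree_count n c = (\<Sum>u\<in>{1..n} \<rightarrow>\<^sub>E UNIV. \<Prod>i\<in>{1..n}.
     cofactors (u i) (1 + c i * (\<Prod>j\<in>neighbors (dynkin_D n) i. u j)))"

lemma tree_weight:
  assumes "n \<ge> 4"
  shows "(\<Prod>i\<in>{1..n}. cofactors (u i) (1 + c i * (\<Prod>j\<in>neighbors (dynkin_D n) i. u j)))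
    = cofactors (u 1) (1 + c 1 * u 3) * cofactors (u 2) (1 + c 2 * u 3) *
      cofactors (u 3) (1 + c 3 * (u 1 * u 2) * u 4) * chain_weight c n 3 (u 3) u"
    (is "prod ?F _ = _")
proof -
  have "{1..n} = insert 1 (insert 2 (insert 3 {3<..n}))"
    using assms by auto
  then have "prod ?F {1..n} = ?F 1 * ?F 2 * ?F 3 * prod ?F {3<..n}"
    by simp
  also have "prod ?F {3<..n} = chain_weight c n 3 (u 3) u"
    unfolding chain_weight_def
  proof (intro prod.cong refl)
    fix i assume i: "i \<in> {3<..n}"
    show "?F i = cofactors (u i) (1 + c i * ((u(3 := u 3)) (i - 1) * (u(Suc n := 1)) (Suc i)))"
    proof (cases "i = n")
      case True
      then show ?thesis using neighbors_dynkin_D(5)[OF assms] by simp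
    next
      case False
      then show ?thesis using neighbors_dynkin_D(4)[OF assms, of i] i by simp
    qed
  qed
  finally show ?thesis
    using neighbors_dynkin_D(1,2,3)[OF assms] by (simp add: mult.assoc)
qed

text \<open>The number of solutions at a leaf with coefficient c next to the value y, written in
  terms of s = -1 / c.\<close>

definition leaf_count :: "'k::{field,finite} \<Rightarrow> 'k \<Rightarrow> real" where
  "leaf_count s y = real CARD('k) - 1 + (if y = s then real CARD('k) else 0)"

lemma leaf_count_commute: "leaf_count s y = leaf_count y s"
  by (simp add: leaf_count_def)

lemma sum_leaf_count:
  fixes s :: "'k::{field,finite}"
  defines "q \<equiv> real CARD('k)"
  assumes "s \<noteq> 0"
  shows "(\<Sum>y\<in>UNIV - {0}. leaf_count s y) = (q - 1)\<^sup>2 + q"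
  unfolding leaf_count_def using assms by (simp add: sum_spike power2_eq_square)

text \<open>Each leaf count is q - 1 plus a peak of height q. The product of the two peaks survives
  only if they coincide.\<close>

lemma sum_leaf_count_mult:
  fixes s s' :: "'k::{field,finite}"
  defines "q \<equiv> real CARD('k)"
  assumes "s \<noteq> 0" and "s' \<noteq> 0"
  shows "(\<Sum>y\<in>UNIV - {0}. leaf_count s y * leaf_count s' y) =
    (q - 1) ^ 3 + 2 * q * (q - 1) + (if s = s' then q\<^sup>2 else 0)"
proof -
  have "leaf_count s y * leaf_count s' y = (q - 1) * leaf_count s y +
      (if y = s' then q * leaf_count s s' else 0)" for y
    by (auto simp: leaf_count_def q_def algebra_simps)
  then have "(\<Sum>y\<in>UNIV - {0}. leaf_count s y * leaf_count s' y) =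
      (q - 1) * (\<Sum>y\<in>UNIV - {0}. leaf_count s y) + q * leaf_count s s'"
    using assms(3) by (simp add: sum.distrib sum_distrib_left)
  also have "\<dots> = (q - 1) * ((q - 1)\<^sup>2 + q) + q * leaf_count s s'"
    using assms by (simp add: sum_leaf_count)
  finally show ?thesis
    by (auto simp: leaf_count_def q_def algebra_simps power2_eq_square power3_eq_cube)
qed

text \<open>A nonzero y = x_3 leaves one choice of x'_3 and decouples the two leaves and the path.
  If x_3 = 0, then x_1 and x_2 are nonzero, x'_3 is free (factor q) and x_4 = -1 / (c_3 x_1 x_2).
  For each of the q - 1 values of x_1, this x_4 runs over all units as x_2 does.\<close>

lemma tree_count_split:
  fixes c :: "nat \<Rightarrow> 'k::{field,finite}"
  defines "q \<equiv> real CARD('k)"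
  assumes n: "n \<ge> 4" and nz: "\<And>i. i \<in> {1..n} \<Longrightarrow> c i \<noteq> 0"
  shows "tree_count n c =
    (\<Sum>y\<in>UNIV - {0}. leaf_count (- 1 / c 1) y *
       leaf_count (- 1 / c 2) y * chain_count c n 3 y) +
    q * (q - 1) * (\<Sum>z\<in>UNIV - {0}. chain_count c n 4 z)"
proof -
  \<comment> \<open>Listing 3 first makes the sum over x_3 the outermost one.\<close>
  have I: "{1..n} = insert 3 (insert 1 (insert 2 {3<..n}))"
    using n by auto
  define G where "G y = (\<Sum>x1\<in>UNIV. \<Sum>x2\<in>UNIV. \<Sum>u\<in>{3<..n} \<rightarrow>\<^sub>E UNIV.
      cofactors x1 (1 + c 1 * y) * cofactors x2 (1 + c 2 * y) *
      (cofactors y (1 + c 3 * (x1 * x2) * u 4) * chain_weight c n 3 y u))" for y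
  have "chain_weight c n 3 y (u(2 := x2, 1 := x1, 3 := y)) = chain_weight c n 3 y u"
    for x1 x2 y :: 'k and u
    unfolding chain_weight_def by (intro prod.cong) auto
  then have "tree_count n c = (\<Sum>y\<in>UNIV. G y)"
    unfolding tree_count_def tree_weight[OF n] G_def unfolding I
    by (simp add: sum_PiE_insert mult.assoc)
  also have "\<dots> = (\<Sum>y\<in>UNIV - {0}. G y) + G 0"
    by (rule sum_nonzero_split)
  also have "(\<Sum>y\<in>UNIV - {0}. G y) =
      (\<Sum>y\<in>UNIV - {0}. leaf_count (- 1 / c 1) y *
       leaf_count (- 1 / c 2) y * chain_count c n 3 y)"
  proof (intro sum.cong refl)
    fix y :: 'k assume "y \<in> UNIV - {0}"
    then have "G y = (\<Sum>x1\<in>UNIV. cofactors x1 (1 + c 1 * y)) *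
        (\<Sum>x2\<in>UNIV. cofactors x2 (1 + c 2 * y)) * chain_count c n 3 y"
      unfolding G_def
      by (simp add: chain_count_def[symmetric] sum_distrib_left[symmetric]
            sum_distrib_right[symmetric] mult.assoc)
    then show "G y = leaf_count (- 1 / c 1) y *
       leaf_count (- 1 / c 2) y * chain_count c n 3 y"
      using nz n by (simp add: sum_cofactors leaf_count_def)
  qed
  also have "G 0 = q * (q - 1) * (\<Sum>z\<in>UNIV - {0}. chain_count c n 4 z)"
  proof -
    have inner: "(\<Sum>u\<in>{3<..n} \<rightarrow>\<^sub>E UNIV. cofactors 0 (1 + d * u 4) * chain_weight c n 3 0 u)
        = q * chain_count c n 4 (- 1 / d)" if "d \<noteq> 0" for d
      using chain_sum_zero[of 3 n "\<lambda>w. cofactors 0 (1 + d * w)" c] n that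
      by (simp add: sum_cofactors_zero q_def)
    have "G 0 = (\<Sum>x1\<in>UNIV - {0}. \<Sum>x2\<in>UNIV - {0}. \<Sum>u\<in>{3<..n} \<rightarrow>\<^sub>E UNIV.
        cofactors 0 (1 + c 3 * (x1 * x2) * u 4) * chain_weight c n 3 0 u)"
      unfolding G_def by (simp add: sum_nonzero_split cofactors_zero)
    also have "\<dots> = (\<Sum>x1\<in>UNIV - {0}. \<Sum>x2\<in>UNIV - {0}.
        q * chain_count c n 4 (- 1 / (c 3 * (x1 * x2))))"
      using nz n by (intro sum.cong refl inner) auto
    also have "\<dots> = (\<Sum>x1\<in>UNIV - {0::'k}. \<Sum>z\<in>UNIV - {0}. q * chain_count c n 4 z)"
    proof (rule sum.cong[OF refl])
      fix x1 :: 'k assume x1: "x1 \<in> UNIV - {0}"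
      show "(\<Sum>x2\<in>UNIV - {0}. q * chain_count c n 4 (- 1 / (c 3 * (x1 * x2)))) =
          (\<Sum>z\<in>UNIV - {0}. q * chain_count c n 4 z)"
        \<comment> \<open>The map is an involution of the units, hence its own inverse.\<close>
        by (rule sum.reindex_bij_witness[where i = "\<lambda>z. - 1 / (c 3 * (x1 * z))"
              and j = "\<lambda>z. - 1 / (c 3 * (x1 * z))"]) (use x1 nz n in auto)
    qed
    finally show ?thesis
      by (simp add: card_units q_def sum_distrib_left mult_ac)
  qed
  finally show ?thesis .
qed

text \<open>Here 3 = n - 2 r, so the path count seen from 3 is constant and the only possible
  coincidence is between the two leaves.\<close>

lemma tree_count_odd:
  fixes c :: "nat \<Rightarrow> 'k::{field,finite}"
  defines "q \<equiv> real CARD('k)"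
  assumes n: "n = 2 * r + 3" "r \<ge> 1" and nz: "\<And>i. i \<in> {1..n} \<Longrightarrow> c i \<noteq> 0"
  shows "tree_count n c = q ^ n - 1 +
    (if c 1 = c 2 then q\<^sup>2 * ((q ^ (n - 1) - 1) / (q\<^sup>2 - 1)) else 0)"
proof -
  have "q > 1" unfolding q_def using card_field_gt_1 by simp
  then have q: "q\<^sup>2 - 1 \<noteq> 0" "q + 1 \<noteq> 0"
    by (auto simp: power2_eq_1_iff)
  have c: "c 1 \<noteq> 0" "c 2 \<noteq> 0" using nz n by auto
  \<comment> \<open>With r = k + 1 the vertex 4 is n - 2 k - 1, an odd level of the path.\<close>
  obtain k where k: "r = Suc k" using n(2) by (cases r) auto
  define d where "d = (q ^ (2 * r + 2) - 1) / (q\<^sup>2 - 1)"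
  have "chain_count c n 3 y = d" if "y \<noteq> 0" for y
    using chain_count_even[of r n c y] that n nz by (simp add: d_def q_def)
  then have "(\<Sum>y\<in>UNIV - {0}. leaf_count (- 1 / c 1) y * leaf_count (- 1 / c 2) y * chain_count c n 3 y)
    = (\<Sum>y\<in>UNIV - {0}. leaf_count (- 1 / c 1) y * leaf_count (- 1 / c 2) y) * d"
    by (simp add: sum_distrib_right)
  moreover have "(\<Sum>y\<in>UNIV - {0}. chain_count c n 4 y) = (q ^ (2 * r + 1) + 1) / (q + 1)"
    using chain_count_odd_sum[of k n c] n nz k by (simp add: q_def numeral_eq_Suc)
  moreover define X where "X = (q - 1) ^ 3 + 2 * q * (q - 1)"
  moreover define Y where "Y = q * (q - 1) * ((q ^ (2 * r + 1) + 1) / (q + 1))"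
  ultimately have "tree_count n c = (X + (if c 1 = c 2 then q\<^sup>2 else 0)) * d + Y"
    using tree_count_split[of n c] nz n c by (simp add: sum_leaf_count_mult q_def)
  moreover have "X * d + Y = q ^ (2 * r + 3) - 1"
    unfolding d_def X_def Y_def using q
    by (simp add: divide_simps power_add power_mult power2_power numeral_eq_Suc) algebra
  ultimately have "tree_count n c = q ^ n - 1 + (if c 1 = c 2 then q\<^sup>2 else 0) * d"
    by (simp add: n distrib_right)
  then show ?thesis
    by (simp add: n d_def)
qed

text \<open>The arguments \<open>s\<close> and \<open>s'\<close> are the values at the vertex \<open>3\<close> which allow the value \<open>0\<close> at the
  leaves \<open>1\<close> and \<open>2\<close>, and \<open>t\<close> is the special value of the path \<open>4, \<dots>, n\<close>.\<close>

definition even_tree_count :: "nat \<Rightarrow> 'k::{field,finite} \<Rightarrow> 'k \<Rightarrow> 'k \<Rightarrow> real" where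
  "even_tree_count r s s' t = (let q = real CARD('k) in
     ((q - 1) ^ 3 + 2 * q * (q - 1) + (if s = s' then q\<^sup>2 else 0)) *
       ((q ^ (r + 1) - 1) * (q ^ (r + 2) - 1) / (q\<^sup>2 - 1)) +
     leaf_count s t * leaf_count s' t * q ^ (r + 1) +
     q * (q - 1) * ((q ^ (2 * r + 2) - 1) / (q + 1)))"

text \<open>Here 3 = n - 2 r - 1, so the path count seen from 3 has its exceptional value at t,
  where both leaf counts must be evaluated. The count seen from 4 is constant.\<close>

lemma tree_count_even:
  fixes c :: "nat \<Rightarrow> 'k::{field,finite}"
  assumes n: "n = 2 * r + 4" and nz: "\<And>i. i \<in> {1..n} \<Longrightarrow> c i \<noteq> 0"
  shows "tree_count n c = even_tree_count r (- 1 / c 1) (- 1 / c 2) (special_value c n r)"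
proof -
  define q where "q = real CARD('k)"
  have c: "c 1 \<noteq> 0" "c 2 \<noteq> 0" using nz n by auto
  define f where "f = (q ^ (r + 1) - 1) * (q ^ (r + 2) - 1) / (q\<^sup>2 - 1)"
  define t where "t = special_value c n r"
  have t: "t \<noteq> 0" unfolding t_def by (rule special_value_nonzero) (use nz n in auto)
  let ?L = "\<lambda>y. leaf_count (- 1 / c 1) y * leaf_count (- 1 / c 2) y"
  have "chain_count c n 3 y = f + (if y = t then q ^ (r + 1) else 0)" if "y \<noteq> 0" for y
    using chain_count_odd[of r n c y] that n nz by (simp add: f_def t_def q_def)
  then have "(\<Sum>y\<in>UNIV - {0}. ?L y * chain_count c n 3 y)
    = (\<Sum>y\<in>UNIV - {0}. ?L y * f + (if y = t then ?L t * q ^ (r + 1) else 0))"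
    by (intro sum.cong refl) (auto simp: algebra_simps)
  also have "\<dots> = (\<Sum>y\<in>UNIV - {0}. ?L y) * f + ?L t * q ^ (r + 1)"
    using t by (simp add: sum.distrib sum_distrib_right)
  finally have "(\<Sum>y\<in>UNIV - {0}. ?L y * chain_count c n 3 y) =
      (\<Sum>y\<in>UNIV - {0}. ?L y) * f + ?L t * q ^ (r + 1)" .
  moreover have "(\<Sum>y\<in>UNIV - {0}. chain_count c n 4 y) = (q ^ (2 * r + 2) - 1) / (q + 1)"
    using chain_count_even_sum[of r n c] n nz by (simp add: q_def)
  ultimately show ?thesis
    using tree_count_split[of n c] nz n c
    by (simp add: sum_leaf_count_mult even_tree_count_def Let_def f_def t_def q_def)
qed

text \<open>Without coincidences both leaf counts at t are q - 1. The exponent r + 2 is half the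
  number of vertices.\<close>

lemma even_tree_count_distinct:
  fixes s :: "'k::{field,finite}"
  assumes "s \<noteq> s'" "s \<noteq> t" "s' \<noteq> t"
  shows "even_tree_count r s s' t = (real CARD('k) ^ (r + 2) - 1)\<^sup>2"
proof -
  define q where "q = real CARD('k)"
  have "q > 1" unfolding q_def using card_field_gt_1 by simp
  then have q: "q\<^sup>2 - 1 \<noteq> 0" "q + 1 \<noteq> 0"
    by (auto simp: power2_eq_1_iff)
  have "((q - 1) ^ 3 + 2 * q * (q - 1)) * ((q ^ (r + 1) - 1) * (q ^ (r + 2) - 1) / (q\<^sup>2 - 1)) +
     (q - 1) * (q - 1) * q ^ (r + 1) + q * (q - 1) * ((q ^ (2 * r + 2) - 1) / (q + 1)) =
     (q ^ (r + 2) - 1)\<^sup>2"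
    using q by (simp add: divide_simps power_add power_mult power2_power numeral_eq_Suc) algebra
  then show ?thesis
    using assms by (simp add: even_tree_count_def leaf_count_def Let_def q_def)
qed

section \<open>Summing the even count over versal parameters\<close>

definition even_versal_count :: "nat \<Rightarrow> real \<Rightarrow> real" where
  "even_versal_count n q = (q ^ (n + 3) - q ^ (n + 2) + q ^ n + q ^ 3 - q + 1) / (q + 1)"

text \<open>The left-hand side is \<open>even_tree_count\<close> summed term by term over two of its
  arguments: constants occur \<open>(q - 1) ^ 2\<close> times, the coincidence of the leaves q - 1
  times, and each sum of a leaf count is \<open>(q - 1) ^ 2 + q\<close>.\<close>

lemma even_versal_count_alt:
  assumes "q > 1"
  shows "((q - 1) ^ 3 + 2 * q * (q - 1)) * (q - 1)\<^sup>2 *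
       ((q ^ (r + 1) - 1) * (q ^ (r + 2) - 1) / (q\<^sup>2 - 1)) +
     (q - 1) * q\<^sup>2 * ((q ^ (r + 1) - 1) * (q ^ (r + 2) - 1) / (q\<^sup>2 - 1)) +
     ((q - 1)\<^sup>2 + q)\<^sup>2 * q ^ (r + 1) +
     (q - 1)\<^sup>2 * (q * (q - 1) * ((q ^ (2 * r + 2) - 1) / (q + 1)))
    = even_versal_count (2 * r + 4) q"
proof -
  have q: "q\<^sup>2 - 1 \<noteq> 0" "q + 1 \<noteq> 0"
    using assms by (auto simp: power2_eq_1_iff)
  show ?thesis
    unfolding even_versal_count_def
    using q by (simp add: divide_simps power_add power_mult power2_power numeral_eq_Suc) algebra
qed

text \<open>The first sum fixes one leaf and lets the other leaf and the special value run; the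
  second fixes the special value and lets both leaves run. The totals agree because
  \<open>leaf_count\<close> is symmetric.\<close>

lemma even_tree_count_sum:
  fixes s :: "'k::{field,finite}"
  assumes "s \<noteq> 0"
  shows "(\<Sum>s'\<in>UNIV - {0}. \<Sum>t\<in>UNIV - {0}. even_tree_count r s s' t) =
    even_versal_count (2 * r + 4) (real CARD('k))" (is ?leaf)
    and "(\<Sum>s'\<in>UNIV - {0}. \<Sum>t\<in>UNIV - {0}. even_tree_count r s' t s) =
    even_versal_count (2 * r + 4) (real CARD('k))" (is ?leaves)
proof -
  define q where "q = real CARD('k)"
  have q: "q > 1" unfolding q_def using card_field_gt_1 by simp
  define f where "f = (q ^ (r + 1) - 1) * (q ^ (r + 2) - 1) / (q\<^sup>2 - 1)"
  define B where "B = ((q - 1) ^ 3 + 2 * q * (q - 1)) * f +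
    q * (q - 1) * ((q ^ (2 * r + 2) - 1) / (q + 1))"
  have T: "even_tree_count r s s' t =
      B + (if s' = s then q\<^sup>2 * f else 0) + q ^ (r + 1) * (leaf_count t s * leaf_count t s')"
    for s s' t :: 'k
    unfolding even_tree_count_def Let_def q_def[symmetric] f_def[symmetric] B_def
    by (auto simp: algebra_simps leaf_count_commute)
  have V: "(q - 1)\<^sup>2 * B + (q - 1) * (q\<^sup>2 * f) + q ^ (r + 1) * ((q - 1)\<^sup>2 + q)\<^sup>2
      = even_versal_count (2 * r + 4) q"
    unfolding even_versal_count_alt[OF q, symmetric] f_def[symmetric] B_def
    by (simp add: algebra_simps)
  have L: "(\<Sum>y\<in>UNIV - {0}. leaf_count s y) = (q - 1)\<^sup>2 + q" if "s \<noteq> 0" for s :: 'k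
    using that by (simp add: sum_leaf_count q_def)
  have L': "(\<Sum>y\<in>UNIV - {0}. leaf_count y s) = (q - 1)\<^sup>2 + q" if "s \<noteq> 0" for s :: 'k
    using L[OF that] by (simp add: leaf_count_commute)
  \<comment> \<open>Only one of the two leaf factors depends on s', so the inner sum over s' is
    explicit.\<close>
  have "(\<Sum>s'\<in>UNIV - {0}. \<Sum>t\<in>UNIV - {0}. even_tree_count r s s' t) =
     (\<Sum>t\<in>UNIV - {0}. \<Sum>s'\<in>UNIV - {0}. even_tree_count r s s' t)"
    by (rule sum.swap)
  also have "\<dots> = (\<Sum>t\<in>UNIV - {0}. (q - 1) * B + q\<^sup>2 * f +
      q ^ (r + 1) * (leaf_count t s * ((q - 1)\<^sup>2 + q)))"
    using assms by (intro sum.cong refl)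
      (simp add: T sum.distrib L card_units q_def flip: sum_distrib_left)
  also have "\<dots> = even_versal_count (2 * r + 4) q"
    unfolding V[symmetric] using assms
    by (simp add: sum.distrib card_units L' flip: sum_distrib_left sum_distrib_right q_def)
      (simp add: algebra_simps power2_eq_square)
  finally show ?leaf by (simp add: q_def)
  have "(\<Sum>s'\<in>UNIV - {0}. \<Sum>t\<in>UNIV - {0}. even_tree_count r s' t s) =
     (\<Sum>s'\<in>UNIV - {0}. (q - 1) * B + q\<^sup>2 * f +
      q ^ (r + 1) * (leaf_count s s' * ((q - 1)\<^sup>2 + q)))"
    using assms by (intro sum.cong refl)
      (simp add: T sum.distrib L card_units q_def flip: sum_distrib_left)
  also have "\<dots> = even_versal_count (2 * r + 4) q"
    unfolding V[symmetric] using assms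
    by (simp add: sum.distrib card_units L flip: sum_distrib_left sum_distrib_right q_def)
      (simp add: algebra_simps power2_eq_square)
  finally show ?leaves by (simp add: q_def)
qed

section \<open>Dependence of the special value on the coefficients\<close>

lemma special_value_cong:
  "(\<And>i. i \<in> {n - 2 * r..n} \<Longrightarrow> c i = c' i) \<Longrightarrow> special_value c n r = special_value c' n r"
proof (induction r)
  case (Suc r)
  have "special_value c n r = special_value c' n r" by (rule Suc.IH) (use Suc.prems in auto)
  then show ?case using Suc.prems[of "n - 2 * Suc r"] by simp
qed simp

text \<open>Each step of the recursion inverts up to a factor, so the special value is proportional
  to any one of its coefficients or to its inverse. Either way it runs over all units when that
  coefficient does.\<close>

lemma special_value_update:
  fixes c :: "nat \<Rightarrow> 'k::{field,finite}"
  assumes "2 * r < n" and "k \<le> r" and "\<And>i. i \<in> {n - 2 * r..n} \<Longrightarrow> c i \<noteq> 0"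
  shows "\<exists>d. d \<noteq> 0 \<and>
    ((\<forall>b. b \<noteq> 0 \<longrightarrow> special_value (c(n - 2 * k := b)) n r = d * b) \<or>
     (\<forall>b. b \<noteq> 0 \<longrightarrow> special_value (c(n - 2 * k := b)) n r = d / b))"
  using assms
proof (induction r)
  case 0
  then show ?case by (intro exI[of _ "- 1"]) auto
next
  case (Suc r)
  define e where "e = c (n - 2 * Suc r)"
  have e: "e \<noteq> 0" unfolding e_def by (rule Suc.prems) auto
  show ?case
  proof (cases "k = Suc r")
    case True
    have "special_value (c(n - 2 * k := b)) n r = special_value c n r" for b
      by (rule special_value_cong) (use True Suc.prems in auto)
    moreover have "special_value c n r \<noteq> 0"
      by (rule special_value_nonzero) (use Suc.prems in auto)
    moreover have "(c(n - 2 * k := b)) (n - 2 * Suc r) = b" for b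
      using True by simp
    \<comment> \<open>The new coefficient enters only in the last step, so the value is d / b with
      this d.\<close>
    ultimately show ?thesis
      unfolding special_value.simps
      by (intro exI[of _ "- 1 / special_value c n r"]) (simp del: fun_upd_apply)
  next
    case False
    then have "\<exists>d. d \<noteq> 0 \<and>
      ((\<forall>b. b \<noteq> 0 \<longrightarrow> special_value (c(n - 2 * k := b)) n r = d * b) \<or>
       (\<forall>b. b \<noteq> 0 \<longrightarrow> special_value (c(n - 2 * k := b)) n r = d / b))"
      using Suc.prems(1,2) by (intro Suc.IH Suc.prems(3)) auto
    then obtain d where d: "d \<noteq> 0"
      "(\<forall>b. b \<noteq> 0 \<longrightarrow> special_value (c(n - 2 * k := b)) n r = d * b) \<or>
       (\<forall>b. b \<noteq> 0 \<longrightarrow> special_value (c(n - 2 * k := b)) n r = d / b)"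
      by blast
    have "special_value (c(n - 2 * k := b)) n (Suc r) =
        - 1 / (e * special_value (c(n - 2 * k := b)) n r)" for b
      using False Suc.prems by (auto simp: e_def)
    \<comment> \<open>The step swaps the two alternatives, with the same new constant in
      both.\<close>
    with d e show ?thesis
      by (intro exI[of _ "- 1 / (e * d)"])
        (auto simp: field_simps simp del: special_value.simps fun_upd_apply)
  qed
qed

lemma sum_scaled_units:
  fixes F :: "'k::{field,finite} \<Rightarrow> real"
  assumes "d \<noteq> 0"
  shows "(\<Sum>b\<in>UNIV - {0}. F (d * b)) = (\<Sum>t\<in>UNIV - {0}. F t)"
    and "(\<Sum>b\<in>UNIV - {0}. F (d / b)) = (\<Sum>t\<in>UNIV - {0}. F t)"
  by (rule sum.reindex_bij_witness[where i = "\<lambda>t. t / d" and j = "\<lambda>b. d * b"];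
      use assms in auto)
    (rule sum.reindex_bij_witness[where i = "\<lambda>t. d / t" and j = "\<lambda>b. d / b"];
      use assms in auto)

lemma sum_special_value:
  fixes c :: "nat \<Rightarrow> 'k::{field,finite}"
  assumes "2 * r < n" and "k \<le> r" and "\<And>i. i \<in> {n - 2 * r..n} \<Longrightarrow> c i \<noteq> 0"
  shows "(\<Sum>b\<in>UNIV - {0}. F (special_value (c(n - 2 * k := b)) n r)) =
    (\<Sum>t\<in>UNIV - {0}. F t :: real)"
proof -
  obtain d where d: "d \<noteq> 0"
    "(\<forall>b. b \<noteq> 0 \<longrightarrow> special_value (c(n - 2 * k := b)) n r = d * b) \<or>
     (\<forall>b. b \<noteq> 0 \<longrightarrow> special_value (c(n - 2 * k := b)) n r = d / b)"
    using special_value_update[of r n k c] assms by blast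
  from d(2) show ?thesis
  proof
    assume "\<forall>b. b \<noteq> 0 \<longrightarrow> special_value (c(n - 2 * k := b)) n r = d * b"
    then show ?thesis
      using sum_scaled_units(1)[OF d(1), of F] by (simp cong: sum.cong_simp)
  next
    assume "\<forall>b. b \<noteq> 0 \<longrightarrow> special_value (c(n - 2 * k := b)) n r = d / b"
    then show ?thesis
      using sum_scaled_units(2)[OF d(1), of F] by (simp cong: sum.cong_simp)
  qed
qed

text \<open>Repeated inversion makes the exponents alternate, starting with -1 at k = r. This brings
  the special value into the shape of the genericity condition.\<close>

lemma special_value_prod:
  fixes c :: "nat \<Rightarrow> 'k::{field,finite}"
  shows "special_value c n r =
    (- 1) ^ Suc r * (\<Prod>k\<le>r. c (n - 2 * k) powi (- ((- 1) ^ (r - k))))"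
proof (induction r)
  case (Suc r)
  have "(\<Prod>k\<le>r. c (n - 2 * k) powi (- ((- 1) ^ (Suc r - k)))) =
      (\<Prod>k\<le>r. inverse (c (n - 2 * k) powi (- ((- 1) ^ (r - k)))))"
    by (intro prod.cong refl) (simp add: Suc_diff_le power_int_minus)
  also have "\<dots> = inverse (\<Prod>k\<le>r. c (n - 2 * k) powi (- ((- 1) ^ (r - k))))"
    using prod_inversef[of "\<lambda>k. c (n - 2 * k) powi (- ((- 1) ^ (r - k)))" "{..r}"]
    by (simp add: o_def)
  finally have P: "(\<Prod>k\<le>r. c (n - 2 * k) powi (- ((- 1) ^ (Suc r - k)))) =
      inverse (\<Prod>k\<le>r. c (n - 2 * k) powi (- ((- 1) ^ (r - k))))" .
  have "inverse ((- 1 :: 'k) ^ r) = (- 1) ^ r"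
    by (simp flip: power_inverse)
  then show ?case
    unfolding special_value.simps prod.atMost_Suc P Suc.IH
    by (simp add: power_int_minus divide_inverse)
qed (simp add: power_int_minus field_simps)

subsection \<open>Colours and maximum matchings\<close>

text \<open>Over fixed b and x the coordinates x'_i can be chosen independently, so each fibre is a
  product of solution sets.\<close>

lemma card_variety_points:
  fixes T :: "'v ugraph" and \<phi> and a :: "'v \<Rightarrow> 'k::{field,finite}"
  assumes "finite (verts T)"
  defines "K \<equiv> vertices_of_kind T \<phi> Versal"
  shows "real (card (variety_points T \<phi> M a)) =
    (\<Sum>b\<in>(uncovered T M \<inter> K) \<rightarrow>\<^sub>E (UNIV - {0}). \<Sum>x\<in>verts T \<rightarrow>\<^sub>E UNIV. \<Prod>i\<in>verts T.
       cofactors (x i) (1 + coefficient M (\<lambda>v. if v \<in> K then b v else a v) i *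
         (\<Prod>j\<in>neighbors T i. x j)))"
proof -
  define R where "R b x i = 1 + coefficient M (\<lambda>v. if v \<in> K then b v else a v) i *
    (\<Prod>j\<in>neighbors T i. x j)" for b x i
  define B :: "('v \<Rightarrow> 'k) set" where "B = (uncovered T M \<inter> K) \<rightarrow>\<^sub>E (UNIV - {0})"
  define X :: "('v \<Rightarrow> 'k) set" where "X = verts T \<rightarrow>\<^sub>E UNIV"
  define Y where "Y b x = (\<Pi>\<^sub>E i\<in>verts T. {t. x i * t = R b x i})" for b x
  have fin: "finite B" "finite X" "finite (Y b x)" for b x
    unfolding B_def X_def Y_def using assms(1) by (auto intro!: finite_PiE simp: uncovered_def)
  have "variety_points T \<phi> M a =
      (\<lambda>(b, x, x'). (x, x', b)) ` (SIGMA b:B. SIGMA x:X. Y b x)"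
    unfolding variety_points_def B_def X_def Y_def R_def K_def
    by (auto simp: PiE_iff image_iff)
  then have "card (variety_points T \<phi> M a) = card (SIGMA b:B. SIGMA x:X. Y b x)"
    by (simp add: card_image inj_on_def case_prod_beta)
  also have "\<dots> = (\<Sum>b\<in>B. \<Sum>x\<in>X. card (Y b x))"
    using fin by simp
  finally show ?thesis
    using assms(1) by (simp add: B_def X_def Y_def R_def card_PiE cofactors_def)
qed

section \<open>Duality of matchings and vertex covers\<close>

lemma matching_representatives:
  assumes "\<Union>(edges T) \<subseteq> verts T" and "matching T M" and "vertex_cover T S"
  obtains f where "inj_on f M" and "\<And>e. e \<in> M \<Longrightarrow> f e \<in> e \<inter> S"
proof -
  have M: "M \<subseteq> edges T" "\<And>v e f. \<lbrakk>v \<in> verts T; e \<in> M; f \<in> M; v \<in> e; v \<in> f\<rbrakk> \<Longrightarrow> e = f"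
    using assms(2) by (auto simp: matching_def)
  have "\<forall>e\<in>M. \<exists>v. v \<in> e \<inter> S"
    using M(1) assms(3) unfolding vertex_cover_def by blast
  then obtain f where f: "\<And>e. e \<in> M \<Longrightarrow> f e \<in> e \<inter> S"
    by metis
  have "inj_on f M"
  proof (rule inj_onI)
    fix e e' assume e: "e \<in> M" "e' \<in> M" "f e = f e'"
    \<comment> \<open>A common representative would lie in two dominoes, which a matching
      forbids.\<close>
    then have "f e \<in> e" "f e \<in> e'" using f[of e] f[of e'] by auto
    then show "e = e'" using M(2)[of "f e" e e'] M(1) assms(1) e by auto
  qed
  with f show thesis by (rule that[rotated])
qed

lemma card_matching_le_cover:
  assumes "\<Union>(edges T) \<subseteq> verts T" and "matching T M" and "vertex_cover T S" and "finite S"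
  shows "card M \<le> card S"
proof -
  obtain f where "inj_on f M" "\<And>e. e \<in> M \<Longrightarrow> f e \<in> e \<inter> S"
    using matching_representatives[OF assms(1-3)] by blast
  then show ?thesis
    using assms(4) by (intro card_inj_on_le[of f]) auto
qed

text \<open>The representatives of the dominoes are distinct elements of S, and by the size bound
  they exhaust it.\<close>

lemma cover_subset_matching:
  assumes "\<Union>(edges T) \<subseteq> verts T" and "matching T M" and "vertex_cover T S" and "finite S"
    and "card S \<le> card M"
  shows "S \<subseteq> \<Union>M"
proof -
  obtain f where f: "inj_on f M" "\<And>e. e \<in> M \<Longrightarrow> f e \<in> e \<inter> S"
    using matching_representatives[OF assms(1-3)] by blast
  have "f ` M \<subseteq> S" using f by auto
  moreover have "card S \<le> card (f ` M)" using f assms(5) by (simp add: card_image)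
  ultimately have "f ` M = S" using assms(4) by (simp add: card_seteq)
  then show ?thesis using f by auto
qed

section \<open>Red-green components\<close>

lemma vertices_of_kind_constant:
  "vertices_of_kind T (\<lambda>_. \<kappa>) \<kappa> = verts (red_green_graph T)"
  by (auto simp: vertices_of_kind_def red_green_components_def connected_components_def quotient_def)

lemma vertices_of_kind_empty:
  "\<kappa> \<noteq> \<kappa>' \<Longrightarrow> vertices_of_kind T (\<lambda>_. \<kappa>) \<kappa>' = {}"
  by (auto simp: vertices_of_kind_def)

lemma connected_component_all:
  assumes "r \<in> verts H" and "\<And>v. v \<in> verts H \<Longrightarrow> (r, v) \<in> {(a, b). adjacent H a b}\<^sup>*"
  shows "verts H \<in> connected_components H"
  unfolding connected_components_def quotient_def using assms by auto

lemma adjacent_red_green_graph: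
  "adjacent (red_green_graph T) u v \<longleftrightarrow>
     adjacent T u v \<and> (red T u \<and> green T v \<or> green T u \<and> red T v)"
  by (auto simp: adjacent_def red_green_graph_def doubleton_eq_iff insert_commute)

section \<open>Vertex covers and matchings of the tree\<close>

definition odd_cover :: "nat \<Rightarrow> nat set" where
  "odd_cover n = {i \<in> {3..n}. odd i}"

text \<open>For odd n this is a second minimum vertex cover, sharing only 3 with
  \<open>odd_cover\<close>.\<close>

definition even_cover :: "nat \<Rightarrow> nat set" where
  "even_cover n = insert 3 {i \<in> {4..n}. even i}"

text \<open>For even \<open>n\<close>, shifting the dominoes at an even \<open>k\<close> leaves \<open>k\<close> uncovered, which excludes \<open>k\<close>
  from all minimum vertex covers.\<close>

definition shifted_edge :: "nat \<Rightarrow> nat \<Rightarrow> nat \<Rightarrow> nat set" where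
  "shifted_edge u k i = (if i = 3 then {u, 3} else if i < k then {i - 1, i} else {i, Suc i})"

text \<open>There is one domino per vertex of \<open>odd_cover\<close>, and u is the leaf matched
  with 3. For k = n + 1 all dominoes beyond 3 point downwards, which makes sense for odd n
  too.\<close>

definition shifted_matching :: "nat \<Rightarrow> nat \<Rightarrow> nat \<Rightarrow> nat set set" where
  "shifted_matching n u k = shifted_edge u k ` odd_cover n"

lemma edges_dynkin_D_subset: "n \<ge> 4 \<Longrightarrow> \<Union>(edges (dynkin_D n)) \<subseteq> verts (dynkin_D n)"
  by (auto simp: dynkin_D_def)

lemma finite_covers [simp]: "finite (odd_cover n)" "finite (even_cover n)"
  by (auto simp: odd_cover_def even_cover_def)

lemma vertex_cover_dynkin_D:
  assumes "n \<ge> 4" and "S \<subseteq> {1..n}" and "3 \<in> S"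
    and "\<And>i. 3 \<le> i \<Longrightarrow> i < n \<Longrightarrow> i \<in> S \<or> Suc i \<in> S"
  shows "vertex_cover (dynkin_D n) S"
  unfolding vertex_cover_def verts_dynkin_D
proof (intro conjI ballI)
  fix e assume "e \<in> edges (dynkin_D n)"
  then consider "3 \<in> e" | i where "e = {i, Suc i}" "3 \<le> i" "i < n"
    using assms(1) by (fastforce simp: dynkin_D_def)
  then show "e \<inter> S \<noteq> {}"
    by cases (use assms(3,4) in blast)+
qed (rule assms(2))

lemma odd_cover_cover: "n \<ge> 4 \<Longrightarrow> vertex_cover (dynkin_D n) (odd_cover n)"
  by (rule vertex_cover_dynkin_D) (auto simp: odd_cover_def)

lemma even_cover_cover: "n \<ge> 4 \<Longrightarrow> vertex_cover (dynkin_D n) (even_cover n)"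
  by (rule vertex_cover_dynkin_D) (auto simp: even_cover_def)

text \<open>Each even v from 4 on is charged to v + 1, which does not exceed n because n is
  odd.\<close>

lemma card_even_cover:
  assumes "n \<ge> 4" and "odd n"
  shows "card (even_cover n) \<le> card (odd_cover n)"
proof -
  have "even_cover n \<subseteq> (\<lambda>i. if i = 3 then 3 else i - 1) ` odd_cover n"
  proof
    fix v assume "v \<in> even_cover n"
    then consider "v = 3" | "4 \<le> v" "v \<le> n" "even v" by (auto simp: even_cover_def)
    then show "v \<in> (\<lambda>i. if i = 3 then 3 else i - 1) ` odd_cover n"
    proof cases
      case 1
      then show ?thesis using assms by (intro image_eqI[of _ _ 3]) (auto simp: odd_cover_def)
    next
      case 2
      then have "v \<noteq> n" using assms by auto
      with 2 show ?thesis by (intro image_eqI[of _ _ "Suc v"]) (auto simp: odd_cover_def)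
    qed
  qed
  then show ?thesis
    by (rule surj_card_le[rotated]) simp
qed

lemma shifted_edge_odd_cover:
  "\<lbrakk>u \<in> {1, 2}; i \<in> odd_cover n; j \<in> odd_cover n; i \<in> shifted_edge u k j\<rbrakk> \<Longrightarrow> i = j"
  by (auto simp: shifted_edge_def odd_cover_def split: if_splits)

lemma card_shifted_matching:
  assumes "u \<in> {1, 2}"
  shows "card (shifted_matching n u k) = card (odd_cover n)"
  unfolding shifted_matching_def
proof (rule card_image, rule inj_onI)
  fix i j assume "i \<in> odd_cover n" "j \<in> odd_cover n" "shifted_edge u k i = shifted_edge u k j"
  moreover have "i \<in> shifted_edge u k i" by (simp add: shifted_edge_def)
  ultimately show "i = j" using shifted_edge_odd_cover[OF assms] by blast
qed

lemma shifted_edge_disjoint: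
  assumes "u \<in> {1, 2}" "i \<in> odd_cover n" "j \<in> odd_cover n" "i < j"
  shows "shifted_edge u k i \<inter> shifted_edge u k j = {}"
proof -
  have "Suc i < j"
    using assms by (cases "j = Suc i") (auto simp: odd_cover_def)
  \<comment> \<open>An upward domino at i is never followed by a downward one at j > i, and i + 2 <=
    j, so these bounds separate the dominoes.\<close>
  moreover have "(if j < k then j - 1 else j) \<le> x" if "x \<in> shifted_edge u k j" for x
    using assms that by (auto simp: shifted_edge_def odd_cover_def split: if_splits)
  moreover have "x \<le> (if i < k then i else Suc i)" if "x \<in> shifted_edge u k i" for x
    using assms that by (auto simp: shifted_edge_def odd_cover_def split: if_splits)
  ultimately show ?thesis using assms(4) by (fastforce split: if_splits)
qed

lemma matching_shifted_matching:
  assumes "n \<ge> 4" "u \<in> {1, 2}" "even n \<or> n < k"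
  shows "matching (dynkin_D n) (shifted_matching n u k)"
  unfolding matching_def
proof (intro conjI ballI impI)
  show "shifted_matching n u k \<subseteq> edges (dynkin_D n)"
  proof
    fix e assume "e \<in> shifted_matching n u k"
    then obtain i where i: "i \<in> odd_cover n" "e = shifted_edge u k i"
      by (auto simp: shifted_matching_def)
    have "i = 3 \<or> 4 < i"
      using i(1) by (cases "i = 4") (auto simp: odd_cover_def)
    \<comment> \<open>An upward domino at n would leave the tree; it does not occur, since either n
      is even or n < k.\<close>
    with i consider "e = {u, 3}" | "e = {i - 1, Suc (i - 1)}" "4 < i" | "e = {i, Suc i}" "3 \<le> i" "i < n"
      using assms(3) by (cases "i = n") (auto simp: shifted_edge_def odd_cover_def split: if_splits)
    then show "e \<in> edges (dynkin_D n)"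
    proof cases
      case 1 then show ?thesis using assms(2) by (auto simp: dynkin_D_def)
    next
      case 2
      then have "3 \<le> i - 1 \<and> i - 1 \<le> n - 1" using i by (auto simp: odd_cover_def)
      with 2 show ?thesis by (auto simp: dynkin_D_def)
    next
      case 3 then show ?thesis by (auto simp: dynkin_D_def)
    qed
  qed
next
  fix v e f assume ef: "e \<in> shifted_matching n u k" "f \<in> shifted_matching n u k" "v \<in> e \<and> v \<in> f"
  then obtain i j where ij: "i \<in> odd_cover n" "e = shifted_edge u k i"
      "j \<in> odd_cover n" "f = shifted_edge u k j"
    by (auto simp: shifted_matching_def)
  then show "e = f"
    using ef(3) shifted_edge_disjoint[OF assms(2), of i n j k] shifted_edge_disjoint[OF assms(2), of j n i k]
    by (cases i j rule: linorder_cases) auto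
qed

lemma shifted_matching_misses:
  assumes "u \<in> {1, 2}"
  shows "v \<in> {1, 2} \<Longrightarrow> v \<noteq> u \<Longrightarrow> v \<notin> \<Union>(shifted_matching n u k)"
    and "even k \<Longrightarrow> k \<ge> 4 \<Longrightarrow> k \<notin> \<Union>(shifted_matching n u k)"
  using assms
  by (auto simp: shifted_matching_def shifted_edge_def odd_cover_def split: if_splits)

lemma card_odd_cover:
  assumes "n = 2 * r + 3 \<or> n = 2 * r + 4"
  shows "card (odd_cover n) = Suc r"
proof -
  have "odd_cover n \<subseteq> (\<lambda>k. 2 * k + 3) ` {..r}"
  proof
    fix i assume i: "i \<in> odd_cover n"
    then obtain b where "i = 2 * b + 1" by (auto simp: odd_cover_def elim: oddE)
    with i assms show "i \<in> (\<lambda>k. 2 * k + 3) ` {..r}"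
      by (intro image_eqI[of _ _ "b - 1"]) (auto simp: odd_cover_def)
  qed
  moreover have "(\<lambda>k. 2 * k + 3) ` {..r} \<subseteq> odd_cover n"
    using assms by (auto simp: odd_cover_def)
  ultimately have "odd_cover n = (\<lambda>k. 2 * k + 3) ` {..r}" by (rule antisym)
  then show ?thesis
    by (simp add: card_image inj_on_def)
qed

section \<open>Minimum vertex covers and colours\<close>

context
  fixes n :: nat
  assumes n: "n \<ge> 4"
begin

lemma finite_cover: "vertex_cover (dynkin_D n) S \<Longrightarrow> finite S"
  unfolding vertex_cover_def verts_dynkin_D by (blast intro: finite_subset[OF _ finite_atLeastAtMost])

lemma card_cover_ge: "vertex_cover (dynkin_D n) S \<Longrightarrow> card (odd_cover n) \<le> card S"
  using card_matching_le_cover[OF edges_dynkin_D_subset[OF n]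
      matching_shifted_matching[OF n, of 1 "Suc n"]] finite_cover
  by (simp add: card_shifted_matching)

lemma minimum_vertex_cover_iff:
  "minimum_vertex_cover (dynkin_D n) S \<longleftrightarrow>
     vertex_cover (dynkin_D n) S \<and> card S \<le> card (odd_cover n)"
proof
  assume "minimum_vertex_cover (dynkin_D n) S"
  then show "vertex_cover (dynkin_D n) S \<and> card S \<le> card (odd_cover n)"
    using odd_cover_cover[OF n] unfolding minimum_vertex_cover_def by blast
next
  assume S: "vertex_cover (dynkin_D n) S \<and> card S \<le> card (odd_cover n)"
  show "minimum_vertex_cover (dynkin_D n) S"
    unfolding minimum_vertex_cover_def
  proof (intro conjI allI impI)
    fix S' assume "vertex_cover (dynkin_D n) S'"
    with S show "card S \<le> card S'" using card_cover_ge[of S'] by simp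
  qed (use S in simp)
qed

text \<open>The matching and S form a tight pair. Each vertex missed for some choice of u and k is
  thereby excluded from S.\<close>

lemma minimum_cover_subset:
  assumes "minimum_vertex_cover (dynkin_D n) S" "u \<in> {1, 2}" "even n \<or> n < k"
  shows "S \<subseteq> \<Union>(shifted_matching n u k)"
proof -
  have S: "vertex_cover (dynkin_D n) S" "card S \<le> card (shifted_matching n u k)"
    using assms(1) unfolding minimum_vertex_cover_iff card_shifted_matching[OF assms(2)] by blast+
  show ?thesis
    by (rule cover_subset_matching[OF edges_dynkin_D_subset[OF n]
          matching_shifted_matching[OF n assms(2,3)] S(1) finite_cover[OF S(1)] S(2)])
qed

lemma minimum_cover_leaves:
  assumes "minimum_vertex_cover (dynkin_D n) S"
  shows "1 \<notin> S" "2 \<notin> S" "3 \<in> S"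
proof -
  show "1 \<notin> S"
    using minimum_cover_subset[OF assms, of 2 "Suc n"] shifted_matching_misses(1)[of 2 1 n "Suc n"]
    by auto
  \<comment> \<open>The edge between 1 and 3 can only be met at 3.\<close>
  then show "3 \<in> S"
    using assms by (auto simp: minimum_vertex_cover_def vertex_cover_def dynkin_D_def)
  show "2 \<notin> S"
    using minimum_cover_subset[OF assms, of 1 "Suc n"] shifted_matching_misses(1)[of 1 2 n "Suc n"]
    by auto
qed

lemma minimum_vertex_cover_even:
  assumes "even n"
  shows "minimum_vertex_cover (dynkin_D n) S \<longleftrightarrow> S = odd_cover n"
proof
  assume S: "minimum_vertex_cover (dynkin_D n) S"
  have "S \<subseteq> odd_cover n"
  proof
    fix v assume v: "v \<in> S"
    then have "v \<in> {1..n}" "v \<noteq> 1" "v \<noteq> 2"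
      using S minimum_cover_leaves[OF S]
      by (auto simp: minimum_vertex_cover_def vertex_cover_def verts_dynkin_D)
    \<comment> \<open>Shifting at k = v leaves v itself uncovered.\<close>
    moreover have "\<not> (even v \<and> v \<ge> 4)"
      using minimum_cover_subset[OF S, of 1 v] shifted_matching_misses(2)[of 1 v n] assms v by auto
    ultimately show "v \<in> odd_cover n"
      by (auto simp: odd_cover_def)
  qed
  moreover have "card (odd_cover n) \<le> card S"
    using S card_cover_ge by (simp add: minimum_vertex_cover_iff)
  ultimately show "S = odd_cover n" by (simp add: card_seteq)
next
  assume "S = odd_cover n"
  then show "minimum_vertex_cover (dynkin_D n) S"
    using odd_cover_cover[OF n] by (simp add: minimum_vertex_cover_iff)
qed

lemma colors_even:
  assumes "even n"
  shows "green (dynkin_D n) v \<longleftrightarrow> v \<in> odd_cover n"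
    and "red (dynkin_D n) v \<longleftrightarrow> v \<in> {1..n} - odd_cover n"
  by (auto simp: green_def red_def minimum_vertex_cover_even[OF assms] verts_dynkin_D odd_cover_def)

text \<open>The two minimum covers share only 3 and together miss only 1 and 2; the matchings
  through either leaf settle these three vertices.\<close>

lemma colors_odd:
  assumes "odd n"
  shows "green (dynkin_D n) v \<longleftrightarrow> v = 3" and "red (dynkin_D n) v \<longleftrightarrow> v \<in> {1, 2}"
proof -
  have covers: "minimum_vertex_cover (dynkin_D n) (odd_cover n)"
      "minimum_vertex_cover (dynkin_D n) (even_cover n)"
    using odd_cover_cover[OF n] even_cover_cover[OF n] card_even_cover[OF n assms]
    by (simp_all add: minimum_vertex_cover_iff)
  show "green (dynkin_D n) v \<longleftrightarrow> v = 3"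
  proof
    assume "green (dynkin_D n) v"
    then have "v \<in> odd_cover n" "v \<in> even_cover n" using covers by (simp_all add: green_def)
    then show "v = 3" by (auto simp: odd_cover_def even_cover_def)
  next
    assume "v = 3"
    then show "green (dynkin_D n) v"
      using minimum_cover_leaves(3) n by (simp add: green_def verts_dynkin_D)
  qed
  show "red (dynkin_D n) v \<longleftrightarrow> v \<in> {1, 2}"
  proof
    assume "red (dynkin_D n) v"
    then have "v \<in> {1..n}" "v \<notin> odd_cover n" "v \<notin> even_cover n"
      using covers by (simp_all add: red_def verts_dynkin_D)
    then have "v < 4" "v \<noteq> 3" "1 \<le> v" by (auto simp: odd_cover_def even_cover_def)
    then show "v \<in> {1, 2}" by auto
  next
    assume "v \<in> {1, 2}"
    then show "red (dynkin_D n) v"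
      using minimum_cover_leaves(1,2) n by (auto simp: red_def verts_dynkin_D)
  qed
qed

section \<open>The vertices left uncovered by a maximum matching\<close>

context
  fixes M
  assumes M: "maximum_matching (dynkin_D n) M"
begin

lemma matching_M: "matching (dynkin_D n) M"
  using M by (simp add: maximum_matching_def)

lemma edge_M: "e \<in> M \<Longrightarrow> e \<in> edges (dynkin_D n)"
  using matching_M unfolding matching_def by blast

lemma edge_M_unique: "\<lbrakk>e \<in> M; f \<in> M; v \<in> e; v \<in> f\<rbrakk> \<Longrightarrow> e = f"
  using matching_M edge_M edges_dynkin_D_subset[OF n] unfolding matching_def by blast

lemma card_maximum_matching: "card M = card (odd_cover n)"
proof (rule antisym)
  show "card M \<le> card (odd_cover n)"
    by (rule card_matching_le_cover[OF edges_dynkin_D_subset[OF n] matching_M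
          odd_cover_cover[OF n]]) simp
  have "matching (dynkin_D n) (shifted_matching n 1 (Suc n))"
    by (rule matching_shifted_matching[OF n]) auto
  then have "card (shifted_matching n 1 (Suc n)) \<le> card M"
    using M unfolding maximum_matching_def by blast
  then show "card (odd_cover n) \<le> card M"
    by (simp add: card_shifted_matching)
qed

lemma uncovered_disjoint:
  assumes "vertex_cover (dynkin_D n) S" "finite S" "card S \<le> card (odd_cover n)"
  shows "uncovered (dynkin_D n) M \<inter> S = {}"
  using cover_subset_matching[OF edges_dynkin_D_subset[OF n] matching_M assms(1,2)] assms(3)
  by (auto simp: card_maximum_matching uncovered_def)

lemma card_uncovered: "card (uncovered (dynkin_D n) M) = n - 2 * card (odd_cover n)"
proof -
  have sub: "\<Union>M \<subseteq> {1..n}"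
    using edges_dynkin_D_subset[OF n] edge_M unfolding verts_dynkin_D by blast
  have "pairwise disjnt M"
    unfolding pairwise_def disjnt_def using edge_M_unique by blast
  moreover have edge: "card e = 2" if "e \<in> M" for e
    using edge_M[OF that] by (auto simp: dynkin_D_def)
  ultimately have "card (\<Union>M) = (\<Sum>e\<in>M. card e)"
    by (intro card_Union_disjoint) (auto intro: card_ge_0_finite)
  also have "\<dots> = 2 * card (odd_cover n)"
    using edge by (simp add: card_maximum_matching)
  finally show ?thesis
    using sub by (simp add: uncovered_def verts_dynkin_D card_Diff_subset finite_subset)
qed

text \<open>Uncovered vertices avoid both minimum covers, which leaves 1 and 2, and counting leaves
  exactly one.\<close>

lemma uncovered_odd:
  assumes "odd n"
  obtains u where "u \<in> {1, 2}" and "uncovered (dynkin_D n) M = {u}"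
proof -
  obtain r where r: "n = 2 * r + 3"
    using assms n by (auto elim!: oddE intro: that[of "(n - 3) div 2"])
  have "uncovered (dynkin_D n) M \<inter> (odd_cover n \<union> even_cover n) = {}"
    using uncovered_disjoint[OF odd_cover_cover[OF n]] card_even_cover[OF n assms]
      uncovered_disjoint[OF even_cover_cover[OF n]] by auto
  then have "uncovered (dynkin_D n) M \<subseteq> {1, 2}"
    using n by (fastforce simp: uncovered_def odd_cover_def even_cover_def verts_dynkin_D)
  moreover have "card (uncovered (dynkin_D n) M) = 1"
    using card_odd_cover[of n r] r unfolding card_uncovered by simp
  then obtain u where "uncovered (dynkin_D n) M = {u}" by (rule card_1_singletonE)
  ultimately show thesis by (intro that[of u]) auto
qed

text \<open>Counting gives two uncovered vertices, both red. At least one is a leaf; v may be the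
  other leaf or an even vertex of the path.\<close>

lemma uncovered_even:
  assumes "even n"
  obtains u v where "u \<in> {1, 2}" and "v \<in> {1..n} - odd_cover n" and "v \<noteq> u"
    and "uncovered (dynkin_D n) M = {u, v}"
proof -
  obtain r where r: "n = 2 * r + 4"
    using assms n by (auto elim!: evenE intro: that[of "(n - 4) div 2"])
  have sub: "uncovered (dynkin_D n) M \<subseteq> {1..n} - odd_cover n"
    using uncovered_disjoint[OF odd_cover_cover[OF n]]
    by (auto simp: uncovered_def verts_dynkin_D)
  have card: "card (uncovered (dynkin_D n) M) = 2"
    using card_odd_cover[of n r] r unfolding card_uncovered by simp
  \<comment> \<open>Dominoes covering both leaves would share the vertex 3.\<close>
  have "1 \<in> uncovered (dynkin_D n) M \<or> 2 \<in> uncovered (dynkin_D n) M"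
  proof (rule ccontr)
    assume "\<not> ?thesis"
    then obtain e f where "e \<in> M" "f \<in> M" "1 \<in> e" "2 \<in> f"
      using n by (auto simp: uncovered_def verts_dynkin_D)
    moreover from this have "e = {1, 3}" "f = {2, 3}"
      using edge_M[of e] edge_M[of f] by (auto simp: dynkin_D_def)
    ultimately show False
      using edge_M_unique[of e f 3] by (auto simp: doubleton_eq_iff)
  qed
  then obtain u where u: "u \<in> {1, 2}" "u \<in> uncovered (dynkin_D n) M" by auto
  obtain x y where "uncovered (dynkin_D n) M = {x, y}" "x \<noteq> y"
    using card unfolding card_2_iff by blast
  moreover from this sub have "x \<in> {1..n} - odd_cover n" "y \<in> {1..n} - odd_cover n"
    by blast+
  moreover have "u = x \<or> u = y"
    using u(2) calculation(1) by blast
  ultimately show thesis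
    using that[of u y] that[of u x] u(1) insert_commute[of x y "{}"] by metis
qed

end

end

subsection \<open>Versal and generic parameters\<close>

lemma even_tree_count_commute: "even_tree_count r s s' t = even_tree_count r s' s t"
  by (simp add: even_tree_count_def Let_def mult.commute eq_commute)

lemma tree_count_cong:
  assumes "\<And>i. i \<in> {1..n} \<Longrightarrow> c i = c' i"
  shows "tree_count n c = tree_count n c'"
  unfolding tree_count_def using assms by (intro sum.cong prod.cong refl) simp

lemma red_green_verts_even:
  assumes "n \<ge> 4" "even n"
  shows "verts (red_green_graph (dynkin_D n)) = {1..n}"
  using assms by (auto simp: red_green_graph_def colors_even odd_cover_def)

lemma red_green_verts_odd:
  assumes "n \<ge> 4" "odd n"
  shows "verts (red_green_graph (dynkin_D n)) = {1, 2, 3}"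
  using assms by (auto simp: red_green_graph_def colors_odd)

text \<open>Every edge of the tree joins a green and a red vertex, so all vertices are reached from
  3. The genericity condition can then be applied to the whole tree.\<close>

lemma component_even:
  assumes n: "n \<ge> 4" and "even n"
  shows "{1..n} \<in> red_green_components (dynkin_D n)"
proof -
  let ?H = "red_green_graph (dynkin_D n)"
  let ?R = "{(a, b). adjacent ?H a b}"
  have adj: "adjacent ?H a b" if "a \<in> odd_cover n \<longleftrightarrow> b \<notin> odd_cover n"
    "adjacent (dynkin_D n) a b" "a \<in> {1..n}" "b \<in> {1..n}" for a b
    using that by (auto simp: adjacent_red_green_graph colors_even[OF assms])
  have leaf: "(3, v) \<in> ?R\<^sup>*" if "v \<in> {1, 2}" for v
    using adj[of 3 v] n that
    by (intro r_into_rtrancl) (auto simp: odd_cover_def adjacent_dynkin_D insert_commute)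
  have chain: "v \<le> n \<longrightarrow> (3, v) \<in> ?R\<^sup>*" if "3 \<le> v" for v
    using that
  proof (induction v rule: dec_induct)
    case (step m)
    have "(m, Suc m) \<in> ?R" if "Suc m \<le> n"
      using adj[of m "Suc m"] step(1) that by (auto simp: odd_cover_def adjacent_dynkin_D)
    with step show ?case by (auto intro: rtrancl_into_rtrancl)
  qed simp
  have "(3, v) \<in> ?R\<^sup>*" if "v \<in> {1..n}" for v
  proof (cases "v \<ge> 3")
    case True
    then show ?thesis using chain that by auto
  next
    case False
    then have "v = 1 \<or> v = 2" using that by auto
    then show ?thesis using leaf by blast
  qed
  then show ?thesis
    using connected_component_all[of 3 ?H] n red_green_verts_even[OF assms]
    by (simp add: red_green_components_def)
qed

lemma component_odd:
  assumes n: "n \<ge> 4" and "odd n"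
  shows "{1, 2, 3} \<in> red_green_components (dynkin_D n)"
proof -
  let ?H = "red_green_graph (dynkin_D n)"
  have "adjacent ?H 3 v" if "v \<in> {1, 2}" for v
    using that n
    by (auto simp: adjacent_red_green_graph colors_odd[OF assms] adjacent_dynkin_D insert_commute)
  then have "(3, v) \<in> {(a, b). adjacent ?H a b}\<^sup>*" if "v \<in> {1, 2, 3}" for v
    using that by (cases "v = 3") (auto intro: r_into_rtrancl)
  then show ?thesis
    using connected_component_all[of 3 ?H] red_green_verts_odd[OF assms]
    by (simp add: red_green_components_def)
qed

section \<open>Point counts in terms of tree counts\<close>

context
  fixes n :: nat and M :: "nat set set" and a :: "nat \<Rightarrow> 'k::{field,finite}"
  assumes n: "n \<ge> 4" and M: "maximum_matching (dynkin_D n) M"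
begin

lemma uncovered_red_green: "uncovered (dynkin_D n) M \<subseteq> verts (red_green_graph (dynkin_D n))"
proof (cases "even n")
  case True
  then show ?thesis
    using red_green_verts_even[OF n] by (auto simp: uncovered_def verts_dynkin_D)
next
  case False
  then show ?thesis
    using uncovered_odd[OF n M False] red_green_verts_odd[OF n False] by auto
qed

lemma versal_count:
  defines "U \<equiv> uncovered (dynkin_D n) M"
  shows "real (card (variety_points (dynkin_D n) (\<lambda>_. Versal) M a)) =
    (\<Sum>b\<in>U \<rightarrow>\<^sub>E (UNIV - {0 :: 'k}). tree_count n (\<lambda>i. if i \<in> U then b i else 1))"
proof -
  let ?c = "\<lambda>b. coefficient M (\<lambda>v. if v \<in> verts (red_green_graph (dynkin_D n)) then b v else a v)"
  have UV: "U \<inter> verts (red_green_graph (dynkin_D n)) = U"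
    using uncovered_red_green unfolding U_def by blast
  have "real (card (variety_points (dynkin_D n) (\<lambda>_. Versal) M a)) =
      (\<Sum>b\<in>U \<rightarrow>\<^sub>E (UNIV - {0}). tree_count n (?c b))"
    using card_variety_points[of "dynkin_D n" "\<lambda>_. Versal" M a] UV
    unfolding vertices_of_kind_constant tree_count_def verts_dynkin_D U_def by simp
  also have "\<dots> = (\<Sum>b\<in>U \<rightarrow>\<^sub>E (UNIV - {0 :: 'k}). tree_count n (\<lambda>i. if i \<in> U then b i else 1))"
  proof (rule sum.cong[OF refl], rule tree_count_cong)
    fix b i assume "i \<in> {1..n}"
    then show "?c b i = (if i \<in> U then b i else 1)"
      using UV by (auto simp: coefficient_def U_def uncovered_def verts_dynkin_D)
  qed
  finally show ?thesis .
qed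

lemma generic_count:
  "real (card (variety_points (dynkin_D n) (\<lambda>_. Generic) M a)) = tree_count n (coefficient M a)"
  using card_variety_points[of "dynkin_D n" "\<lambda>_. Generic" M a]
    vertices_of_kind_empty[of Generic Versal "dynkin_D n"]
  unfolding tree_count_def verts_dynkin_D by simp

text \<open>The coefficient z of the uncovered leaf runs over the units while the other leaf has
  coefficient 1, so the leaves coincide once, at z = 1.\<close>

lemma versal_odd:
  defines "q \<equiv> real CARD('k)"
  assumes "odd n"
  shows "real (card (variety_points (dynkin_D n) (\<lambda>_. Versal) M a)) =
    (q ^ (n + 3) - q ^ (n + 2) + q ^ n - q ^ 3 + q - 1) / (q\<^sup>2 - 1)"
proof -
  obtain u where u: "u \<in> {1, 2}" "uncovered (dynkin_D n) M = {u}"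
    using uncovered_odd[OF n M assms(2)] by blast
  have "\<exists>r. n = 2 * r + 3 \<and> r \<ge> 1"
    using n assms(2) by presburger
  then obtain r where r: "n = 2 * r + 3" "r \<ge> 1" by blast
  define d where "d = q\<^sup>2 * ((q ^ (n - 1) - 1) / (q\<^sup>2 - 1))"
  have fn: "(\<lambda>i. if i = u then (b(u := z)) i else 1) = (\<lambda>_. 1)(u := z)"
    for b and z :: 'k
    by auto
  have "real (card (variety_points (dynkin_D n) (\<lambda>_. Versal) M a)) =
      (\<Sum>z\<in>UNIV - {0}. tree_count n ((\<lambda>_. 1 :: 'k)(u := z)))"
    unfolding versal_count u(2) by (simp add: sum_PiE_insert fn del: fun_upd_apply)
  also have "\<dots> = (\<Sum>z\<in>UNIV - {0::'k}. q ^ n - 1 + (if z = 1 then d else 0))"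
  proof (rule sum.cong[OF refl])
    fix z :: 'k assume "z \<in> UNIV - {0}"
    then show "tree_count n ((\<lambda>_. 1)(u := z)) = q ^ n - 1 + (if z = 1 then d else 0)"
      using tree_count_odd[OF r, of "(\<lambda>_. 1)(u := z)"] u(1)
      by (auto simp: d_def q_def)
  qed
  also have "\<dots> = (q - 1) * (q ^ n - 1) + d"
    unfolding q_def by (rule sum_spike) simp
  also have "\<dots> = (q ^ (n + 3) - q ^ (n + 2) + q ^ n - q ^ 3 + q - 1) / (q\<^sup>2 - 1)"
  proof -
    have "q > 1" unfolding q_def using card_field_gt_1 by simp
    then have "q\<^sup>2 - 1 \<noteq> 0" by (auto simp: power2_eq_1_iff)
    moreover obtain m where "n = Suc m" using n by (cases n) auto
    ultimately show ?thesis
      unfolding d_def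
      by (simp add: divide_simps power_add numeral_eq_Suc) (simp add: algebra_simps)
  qed
  finally show ?thesis .
qed

text \<open>If both leaves are uncovered, both leaf arguments run and the special value is fixed.
  Otherwise one leaf has coefficient 1, and the uncovered path vertex makes the special value run
  over the units.\<close>

lemma versal_even:
  defines "q \<equiv> real CARD('k)"
  assumes "even n"
  shows "real (card (variety_points (dynkin_D n) (\<lambda>_. Versal) M a)) = even_versal_count n q"
proof -
  obtain u v where uv: "u \<in> {1, 2}" "v \<in> {1..n} - odd_cover n" "v \<noteq> u"
      "uncovered (dynkin_D n) M = {u, v}"
    using uncovered_even[OF n M assms(2)] by blast
  have "\<exists>r. n = 2 * r + 4"
    using n assms(2) by presburger
  then obtain r where r: "n = 2 * r + 4" by blast
  let ?c = "\<lambda>z w. (\<lambda>_. 1 :: 'k)(v := w, u := z)"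
  \<comment> \<open>Passing from a coefficient z to -1 / z permutes the units.\<close>
  have inv: "(\<Sum>z\<in>UNIV - {0}. F (- 1 / z)) = (\<Sum>z\<in>UNIV - {0}. F z)" for F :: "'k \<Rightarrow> real"
    by (rule sum_scaled_units(2)) simp
  have fn: "(\<lambda>i. if i = u \<or> i = v then (b(v := w, u := z)) i else 1) = ?c z w" for b z w
    using uv(3) by auto
  have "real (card (variety_points (dynkin_D n) (\<lambda>_. Versal) M a)) =
      (\<Sum>z\<in>UNIV - {0}. \<Sum>w\<in>UNIV - {0}. tree_count n (?c z w))"
    unfolding versal_count uv(4) using uv(3)
    by (simp add: sum_PiE_insert fn del: fun_upd_apply)
  also have "\<dots> = (\<Sum>z\<in>UNIV - {0}. \<Sum>w\<in>UNIV - {0}.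
      even_tree_count r (- 1 / ?c z w 1) (- 1 / ?c z w 2) (special_value (?c z w) n r))"
    by (intro sum.cong refl tree_count_even[OF r]) auto
  also have "\<dots> = even_versal_count n q"
  proof (cases "v \<in> {1, 2}")
    case True
    define t where "t = special_value (\<lambda>_. 1 :: 'k) n r"
    have t: "t \<noteq> 0" unfolding t_def by (rule special_value_nonzero) simp
    have "special_value (?c z w) n r = t" for z w
      unfolding t_def by (rule special_value_cong) (use True uv(1) r in auto)
    then have "even_tree_count r (- 1 / ?c z w 1) (- 1 / ?c z w 2) (special_value (?c z w) n r) =
        even_tree_count r (- 1 / z) (- 1 / w) t" for z w
      using uv(1,3) True even_tree_count_commute[of r "- 1 / z" "- 1 / w" t] by auto
    then show ?thesis
      using inv[of "\<lambda>x. \<Sum>w\<in>UNIV - {0}. even_tree_count r x (- 1 / w) t"]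
        inv[of "\<lambda>y. even_tree_count r _ y t"] even_tree_count_sum(2)[OF t, of r]
      by (simp add: r q_def)
  next
    case False
    have "v \<noteq> 3" "even v" "1 \<le> v" "v \<le> n"
      using uv(2) n False by (auto simp: odd_cover_def)
    then obtain k where k: "v = n - 2 * k" "k \<le> r"
      using False r by (auto elim!: evenE intro: that[of "(n - v) div 2"])
    have sv: "special_value (?c z w) n r = special_value ((\<lambda>_. 1)(n - 2 * k := w)) n r" for z w
      by (rule special_value_cong) (use uv(1) k r in auto)
    \<comment> \<open>The covered leaf gives the argument -1; for u = 1 it stands second and the
      leaves are swapped.\<close>
    have "even_tree_count r (- 1 / ?c z w 1) (- 1 / ?c z w 2) (special_value (?c z w) n r) =
        even_tree_count r (- 1) (- 1 / z) (special_value ((\<lambda>_. 1)(n - 2 * k := w)) n r)" for z w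
      unfolding sv using uv(1,3) False even_tree_count_commute[of r "- 1 / z" "- 1"] by auto
    moreover have "(\<Sum>w\<in>UNIV - {0}. F (special_value ((\<lambda>_. 1 :: 'k)(n - 2 * k := w)) n r)) =
        (\<Sum>t\<in>UNIV - {0}. F t :: real)" for F
      by (rule sum_special_value) (use k r in auto)
    ultimately show ?thesis
      using inv[of "\<lambda>x. \<Sum>t\<in>UNIV - {0}. even_tree_count r (- 1) x t"]
        even_tree_count_sum(1)[of "- 1 :: 'k" r]
      by (simp add: r q_def)
  qed
  finally show ?thesis .
qed

section \<open>Coincidences excluded by genericity\<close>

context
  assumes generic: "generic_parameters (dynkin_D n) (\<lambda>_. Generic) M a"
begin

lemma generic_coefficient_nonzero: "i \<in> {1..n} \<Longrightarrow> coefficient M a i \<noteq> 0"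
  using generic uncovered_red_green
  unfolding generic_parameters_def vertices_of_kind_constant coefficient_def
  by (auto simp: uncovered_def verts_dynkin_D)

lemma genericity:
  assumes "C \<in> red_green_components (dynkin_D n)" "admissible (dynkin_D n) C S"
    "sign_choice (dynkin_D n) C S \<epsilon>"
  shows "(\<Prod>i\<in>S. coefficient M a i powi \<epsilon> i) \<noteq> (- 1) ^ card S"
  using generic assms unfolding generic_parameters_def genericity_condition_def by blast

text \<open>The admissible set \<open>{1, 2}\<close>.\<close>

lemma generic_leaves: "coefficient M a 1 \<noteq> coefficient M a 2"
proof -
  define C where "C = (if even n then {1..n} else {1, 2, 3})"
  define \<epsilon> :: "nat \<Rightarrow> int" where "\<epsilon> i = (if i = 1 then 1 else - 1)" for i
  have C: "C \<in> red_green_components (dynkin_D n)"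
    using component_even[OF n] component_odd[OF n] by (simp add: C_def)
  have red: "{1, 2} \<subseteq> {v \<in> C. red (dynkin_D n) v}"
    using n by (auto simp: C_def colors_even[OF n] colors_odd[OF n] odd_cover_def)
  have "card (neighbors (dynkin_D n) w \<inter> {1, 2}) \<in> {0, 2}" if "green (dynkin_D n) w" for w
  proof (cases "w = 3")
    case True
    have "neighbors (dynkin_D n) 3 \<inter> {1, 2} = {1, 2}"
      using neighbors_dynkin_D(3)[OF n] by auto
    with True show ?thesis by simp
  next
    case False
    then have "neighbors (dynkin_D n) w \<inter> {1, 2} = {}"
      using that by (auto simp: neighbors_def adjacent_dynkin_D doubleton_eq_iff
          green_def verts_dynkin_D)
    then show ?thesis by simp
  qed
  with red have adm: "admissible (dynkin_D n) C {1, 2}" by (simp add: admissible_def)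
  have "sign_choice (dynkin_D n) C {1, 2} \<epsilon>"
    by (auto simp: sign_choice_def \<epsilon>_def)
  \<comment> \<open>The condition reads c_1 / c_2 \<noteq> 1, because the set has two
    elements.\<close>
  from genericity[OF C adm this] show ?thesis
    using generic_coefficient_nonzero[of 2] n
    by (auto simp: \<epsilon>_def power_int_minus)
qed

text \<open>The admissible set consisting of a leaf \<open>u\<close> and the even vertices from \<open>4\<close> on.\<close>

lemma generic_special_value:
  assumes r: "n = 2 * r + 4" and u: "u \<in> {1, 2}"
  shows "- 1 / coefficient M a u \<noteq> special_value (coefficient M a) n r"
proof
  \<comment> \<open>These are the even vertices from 4 on, indexed as in
    \<open>special_value_prod\<close>.\<close>
  define E where "E = (\<lambda>k. n - 2 * k) ` {..r}"
  \<comment> \<open>Signs alternate along u, 4, 6, ..., n, since consecutive terms share the green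
    vertex between them; u and 4 share 3.\<close>
  define \<epsilon> :: "nat \<Rightarrow> int" where "\<epsilon> i = (if i = u then 1 else - ((- 1) ^ ((i - 4) div 2)))" for i
  have even: "even n" using r by simp
  have E: "i \<in> E \<longleftrightarrow> even i \<and> 4 \<le> i \<and> i \<le> n" for i
  proof
    assume "even i \<and> 4 \<le> i \<and> i \<le> n"
    then show "i \<in> E" unfolding E_def using r
      by (intro image_eqI[of _ _ "(n - i) div 2"]) (auto elim!: evenE)
  qed (auto simp: E_def r)
  have uE: "u \<notin> E" using u E by auto
  have inj: "inj_on (\<lambda>k. n - 2 * k) {..r}"
    using r by (auto simp: inj_on_def)
  then have finE: "finite E" "card E = Suc r"
    by (auto simp: E_def card_image)
  have C: "{1..n} \<in> red_green_components (dynkin_D n)"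
    by (rule component_even[OF n even])
  have nb: "neighbors (dynkin_D n) w \<inter> insert u E = (if w = 3 then {u, 4} else {w - 1, Suc w})"
    if "green (dynkin_D n) w" for w
  proof -
    have w: "odd w" "3 \<le> w" "w < n"
      using that even by (auto simp: colors_even[OF n even] odd_cover_def le_less)
    show ?thesis
    proof (cases "w = 3")
      case True
      then show ?thesis using neighbors_dynkin_D(3)[OF n] u n E by auto
    next
      case False
      then have "5 \<le> w" using w by (cases "w = 4") auto
      then have "neighbors (dynkin_D n) w = {w - 1, Suc w}" "w - 1 \<in> E" "Suc w \<in> E"
        using neighbors_dynkin_D(4)[OF n, of w] w E by auto
      then show ?thesis using False by auto
    qed
  qed
  have "card (neighbors (dynkin_D n) w \<inter> insert u E) \<in> {0, 2}" if "green (dynkin_D n) w" for w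
    using nb[OF that] u by auto
  moreover have "insert u E \<subseteq> {v \<in> {1..n}. red (dynkin_D n) v}"
  proof
    fix v assume "v \<in> insert u E"
    then have "v = 1 \<or> v = 2 \<or> even v \<and> 4 \<le> v \<and> v \<le> n" using u E[of v] by blast
    then have "v \<in> {1..n} - odd_cover n" using n by (auto simp: odd_cover_def)
    then show "v \<in> {v \<in> {1..n}. red (dynkin_D n) v}" by (simp add: colors_even[OF n even])
  qed
  ultimately have adm: "admissible (dynkin_D n) {1..n} (insert u E)"
    by (simp add: admissible_def)
  have "\<epsilon> i = - \<epsilon> j"
    if "i \<in> insert u E" "j \<in> insert u E" "i \<noteq> j" "green (dynkin_D n) w"
      "adjacent (dynkin_D n) i w" "adjacent (dynkin_D n) j w" for i j w
  proof -
    have ij: "i \<in> neighbors (dynkin_D n) w \<inter> insert u E" "j \<in> neighbors (dynkin_D n) w \<inter> insert u E"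
      using that(1,2,5,6) u n E[of i] E[of j]
      unfolding neighbors_def adjacent_def verts_dynkin_D insert_commute[of w] by auto
    have w: "odd w" "3 \<le> w"
      using that(4) by (auto simp: colors_even[OF n even] odd_cover_def)
    show ?thesis
    proof (cases "w = 3")
      case True
      then have "i \<in> {u, 4}" "j \<in> {u, 4}" using ij unfolding nb[OF that(4)] by simp_all
      moreover have "\<epsilon> u = 1" "\<epsilon> 4 = - 1" using u by (auto simp: \<epsilon>_def)
      ultimately show ?thesis using that(3) by fastforce
    next
      case False
      then obtain m where m: "w = 2 * m + 5"
        using w by (auto elim!: oddE intro: that[of "(w - 5) div 2"])
      have "\<epsilon> (w - 1) = - \<epsilon> (Suc w)"
        using u m by (auto simp: \<epsilon>_def)
      moreover have "i \<in> {w - 1, Suc w}" "j \<in> {w - 1, Suc w}"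
        using ij False unfolding nb[OF that(4)] by simp_all
      ultimately show ?thesis using that(3) by fastforce
    qed
  qed
  moreover have "\<epsilon> i \<in> {1, - 1}" for i
    using minus_one_power_iff[of "(i - 4) div 2", where 'a = int] by (simp add: \<epsilon>_def)
  ultimately have sign: "sign_choice (dynkin_D n) {1..n} (insert u E) \<epsilon>"
    unfolding sign_choice_def by blast
  define P where "P = (\<Prod>k\<le>r. coefficient M a (n - 2 * k) powi (- ((- 1) ^ (r - k))))"
  have "(\<Prod>i\<in>E. coefficient M a i powi \<epsilon> i) = P"
    unfolding E_def P_def
  proof (subst prod.reindex[OF inj])
    show "prod ((\<lambda>i. coefficient M a i powi \<epsilon> i) \<circ> (\<lambda>k. n - 2 * k)) {..r} =
      (\<Prod>k\<le>r. coefficient M a (n - 2 * k) powi (- ((- 1) ^ (r - k))))"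
    proof (intro prod.cong refl)
      fix k assume k: "k \<in> {..r}"
      \<comment> \<open>Hence the sign at n - 2 k is exactly the exponent in
        \<open>special_value_prod\<close>.\<close>
      then have "n - 2 * k - 4 = 2 * (r - k)" "n - 2 * k \<noteq> u" using r u by auto
      then show "((\<lambda>i. coefficient M a i powi \<epsilon> i) \<circ> (\<lambda>k. n - 2 * k)) k =
          coefficient M a (n - 2 * k) powi (- ((- 1) ^ (r - k)))"
        by (simp add: \<epsilon>_def)
    qed
  qed
  then have "coefficient M a u * P \<noteq> (- 1) ^ Suc (Suc r)"
    using genericity[OF C adm sign] finE uE by (simp add: \<epsilon>_def)
  \<comment> \<open>A coincidence would give c_u P = \<open>(- 1) ^ r\<close>, the value just
    excluded for a set of r + 2 elements.\<close>
  moreover assume "- 1 / coefficient M a u = special_value (coefficient M a) n r"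
  then have "- 1 = coefficient M a u * ((- 1) ^ Suc r * P)"
    using generic_coefficient_nonzero[of u] u n
    unfolding special_value_prod P_def by (auto simp: field_simps)
  then have "coefficient M a u * P * (- 1) ^ r = 1"
    by (simp add: mult_ac)
  then have "coefficient M a u * P * ((- 1) ^ r * (- 1) ^ r) = (- 1) ^ r"
    by (metis mult.assoc mult_1)
  then have "coefficient M a u * P = (- 1) ^ r"
    by (simp flip: power_mult_distrib)
  ultimately show False by simp
qed

end

end

theorem proposition4p11:
  fixes n :: nat
    and M :: "nat set set"
    and a :: "nat \<Rightarrow> 'k::{field, finite}"
    and q :: real
  assumes "n \<ge> 4"
    and "q = real CARD('k)"
    and "maximum_matching (dynkin_D n) M"
  shows "(even n \<longrightarrow>
            real (card (variety_points (dynkin_D n) (\<lambda>_. Versal) M a))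
              = (q ^ (n + 3) - q ^ (n + 2) + q ^ n + q ^ 3 - q + 1) / (q + 1) \<and>
            (generic_parameters (dynkin_D n) (\<lambda>_. Generic) M a \<longrightarrow>
             real (card (variety_points (dynkin_D n) (\<lambda>_. Generic) M a))
              = (q ^ (n div 2) - 1) ^ 2)) \<and>
         (odd n \<longrightarrow>
            real (card (variety_points (dynkin_D n) (\<lambda>_. Versal) M a))
              = (q ^ (n + 3) - q ^ (n + 2) + q ^ n - q ^ 3 + q - 1) / (q ^ 2 - 1) \<and>
            (generic_parameters (dynkin_D n) (\<lambda>_. Generic) M a \<longrightarrow>
             real (card (variety_points (dynkin_D n) (\<lambda>_. Generic) M a))
              = q ^ n - 1))"
proof (intro conjI impI)
  note n = assms(1) and q = assms(2) and M = assms(3)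
  {
    assume "even n"
    then show "real (card (variety_points (dynkin_D n) (\<lambda>_. Versal) M a))
        = (q ^ (n + 3) - q ^ (n + 2) + q ^ n + q ^ 3 - q + 1) / (q + 1)"
      using versal_even[OF n M, of a] by (simp add: q even_versal_count_def)
    assume generic: "generic_parameters (dynkin_D n) (\<lambda>_. Generic) M a"
    have "\<exists>r. n = 2 * r + 4"
      using n \<open>even n\<close> by presburger
    then obtain r where r: "n = 2 * r + 4" by blast
    let ?c = "coefficient M a"
    have "?c 1 \<noteq> 0" "?c 2 \<noteq> 0"
      using generic_coefficient_nonzero[OF n M generic] n by auto
    then have "- 1 / ?c 1 \<noteq> - 1 / ?c 2"
      using generic_leaves[OF n M generic] by (simp add: field_simps)
    then have "even_tree_count r (- 1 / ?c 1) (- 1 / ?c 2) (special_value ?c n r) =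
        (q ^ (r + 2) - 1)\<^sup>2"
      unfolding q using generic_special_value[OF n M generic r]
      by (intro even_tree_count_distinct) auto
    moreover have "n div 2 = r + 2" using r by simp
    ultimately show "real (card (variety_points (dynkin_D n) (\<lambda>_. Generic) M a))
        = (q ^ (n div 2) - 1) ^ 2"
      using generic_count[OF n M, of a] tree_count_even[OF r, of ?c]
        generic_coefficient_nonzero[OF n M generic] by simp
  next
    assume "odd n"
    then show "real (card (variety_points (dynkin_D n) (\<lambda>_. Versal) M a))
        = (q ^ (n + 3) - q ^ (n + 2) + q ^ n - q ^ 3 + q - 1) / (q ^ 2 - 1)"
      using versal_odd[OF n M, of a] by (simp add: q)
    assume generic: "generic_parameters (dynkin_D n) (\<lambda>_. Generic) M a"
    have "\<exists>r. n = 2 * r + 3 \<and> r \<ge> 1"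
      using n \<open>odd n\<close> by presburger
    then obtain r where r: "n = 2 * r + 3" "r \<ge> 1" by blast
    show "real (card (variety_points (dynkin_D n) (\<lambda>_. Generic) M a)) = q ^ n - 1"
      using generic_count[OF n M, of a] tree_count_odd[OF r, of "coefficient M a"]
        generic_coefficient_nonzero[OF n M generic] generic_leaves[OF n M generic] q by simp
  }
qed

end
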